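(* Let $f(z)=\sum_{k\ge 0}a_kz^k\in\mathbb{Z}[[z]]$ be a generalized Liouville series of bounded type, and let $m$ be a positive integer. Then $f(\alpha)\in U_m$ for all but finitely many simple algebraic integers $\alpha$ of degree $m$ with $|\alpha|<1$.
   Context: Throughout, power series $f(z)=\sum_{k\ge0}a_kz^k$ have integer coefficients, positive radius of convergence $R_f$, and infinitely many non-zero coefficients. Such an $f$ is called a generalized Liouville series if there exist integer sequences $(s_n)_{n\ge1}$, $(t_n)_{n\ge0}$ such that: $0\le t_0\le s_1<t_1\le s_2<t_2\le s_3<\cdots$ (that is, $t_{n-1}\le s_n<t_n$ for all $n\ge1$); $a_k=0$ for $k<t_0$ and for $s_n<k<t_n$ ($n=1,2,\ldots$); $t_n/s_n\to\infty$ as $n\to\infty$; and the quotients $s_{n+1}/t_n$ ($n\ge1$) are bounded. The series $f$ is of bounded type if there exists $A>0$ such that $|a_k|\le A$ for all $k$; in this case $R_f=1$. Algebraic numbers are complex algebraic numbers, and the degree is the degree over $\mathbb{Q}$. An algebraic number $\alpha$ is called simple if the number field $\mathbb{Q}(\alpha)$ has no proper subfield other than $\mathbb{Q}$: $\mathbb{Q}\subset K\subset\mathbb{Q}(\alpha)$ implies $K=\mathbb{Q}$ or $K=\mathbb{Q}(\alpha)$. For a complex algebraic number $\beta$, its minimal polynomial $M_\beta(T)\in\mathbb{Z}[T]$ is the polynomial, irreducible in the ring $\mathbb{Z}[T]$, vanishing at $\beta$ (unique up to sign); $|M_\beta|$ denotes the maximum of the absolute values of its coefficients. For a positive integer $m$,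 $U_m$ is the set of complex transcendental numbers $\gamma$ such that $m$ is the smallest positive integer with the property: for every $w>0$ there exist infinitely many complex algebraic numbers $\beta$ of degree $m$ satisfying $|\gamma-\beta|<|M_\beta|^{-w}$. *)

theory Defs
  imports "HOL-Analysis.Analysis" "HOL-Computational_Algebra.Computational_Algebra"
begin

definition complex_series :: "int fps \<Rightarrow> complex fps" where
  "complex_series f = Abs_fps (\<lambda>k. of_int (fps_nth f k))"

text \<open>
  The gap sequences are nonnegative by the first chain of inequalities, so they are
  taken in \<^typ>\<open>nat\<close>. The sequence \<open>s\<close> starts at index \<open>1\<close>; the value \<open>s 0\<close> is irrelevant.
\<close>
definition generalized_liouville :: "int fps \<Rightarrow> bool" where
  "generalized_liouville f \<longleftrightarrow>
     infinite {k. fps_nth f k \<noteq> 0} \<and>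
     fps_conv_radius (complex_series f) > 0 \<and>
     (\<exists>s t :: nat \<Rightarrow> nat.
        (\<forall>n\<ge>1. t (n - 1) \<le> s n \<and> s n < t n) \<and>
        (\<forall>k<t 0. fps_nth f k = 0) \<and>
        (\<forall>n\<ge>1. \<forall>k. s n < k \<and> k < t n \<longrightarrow> fps_nth f k = 0) \<and>
        filterlim (\<lambda>n. real (t n) / real (s n)) at_top sequentially \<and>
        (\<exists>B. \<forall>n\<ge>1. real (s (n + 1)) / real (t n) \<le> B))"

definition bounded_type :: "int fps \<Rightarrow> bool" where
  "bounded_type f \<longleftrightarrow> (\<exists>A::real. A > 0 \<and> (\<forall>k. \<bar>of_int (fps_nth f k)\<bar> \<le> A))"

text \<open>Closure under \<^const>\<open>inverse\<close> needs no exception for \<open>0\<close>, as \<open>inverse 0 = 0\<close>.\<close>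
definition complex_subfield :: "complex set \<Rightarrow> bool" where
  "complex_subfield K \<longleftrightarrow>
     1 \<in> K \<and> (\<forall>x\<in>K. \<forall>y\<in>K. x - y \<in> K \<and> x * y \<in> K) \<and> (\<forall>x\<in>K. inverse x \<in> K)"

definition rat_adjoin :: "complex \<Rightarrow> complex set" where
  "rat_adjoin \<alpha> = \<Inter>{K. complex_subfield K \<and> \<alpha> \<in> K}"

definition rat_scale :: "rat \<Rightarrow> complex \<Rightarrow> complex" where
  "rat_scale q z = of_rat q * z"

lemma vector_space_rat_scale: "vector_space rat_scale"
  by standard (simp_all add: rat_scale_def of_rat_add of_rat_mult algebra_simps)

text \<open>The degree \<open>[\<rat>(\<alpha>) : \<rat>]\<close>; meaningful for algebraic \<open>\<alpha>\<close> only.\<close>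
definition alg_degree :: "complex \<Rightarrow> nat" where
  "alg_degree \<alpha> = vector_space.dim rat_scale (rat_adjoin \<alpha>)"

definition simple_algebraic :: "complex \<Rightarrow> bool" where
  "simple_algebraic \<alpha> \<longleftrightarrow> algebraic \<alpha> \<and>
     (\<forall>K. complex_subfield K \<and> K \<subseteq> rat_adjoin \<alpha> \<longrightarrow> K = \<rat> \<or> K = rat_adjoin \<alpha>)"

text \<open>Irreducibility in \<open>\<int>[T]\<close> (not \<open>\<rat>[T]\<close>), so a minimal polynomial is primitive.\<close>
definition is_min_int_poly :: "int poly \<Rightarrow> complex \<Rightarrow> bool" where
  "is_min_int_poly M \<beta> \<longleftrightarrow> irreducible M \<and> poly (map_poly of_int M) \<beta> = 0"

definition min_int_poly :: "complex \<Rightarrow> int poly" where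
  "min_int_poly \<beta> = (SOME M. is_min_int_poly M \<beta>)"

definition poly_height :: "int poly \<Rightarrow> int" where
  "poly_height p = Max {\<bar>coeff p i\<bar> |i. i \<le> degree p}"

definition U_approx :: "nat \<Rightarrow> complex \<Rightarrow> bool" where
  "U_approx m \<gamma> \<longleftrightarrow>
     (\<forall>w::real. w > 0 \<longrightarrow>
        infinite {\<beta>. algebraic \<beta> \<and> alg_degree \<beta> = m \<and>
                     cmod (\<gamma> - \<beta>) < real_of_int (poly_height (min_int_poly \<beta>)) powr (- w)})"

definition U_set :: "nat \<Rightarrow> complex set" where
  "U_set m = {\<gamma>. \<not> algebraic \<gamma> \<and> m > 0 \<and> U_approx m \<gamma> \<and>
                 (\<forall>k. 0 < k \<and> k < m \<longrightarrow> \<not> U_approx k \<gamma>)}"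

text \<open>
  Existence of a minimal polynomial and its uniqueness up to sign. Hence the choice in
  \<^const>\<open>min_int_poly\<close> is harmless: the height does not depend on it.
\<close>

lemma ipoly_mult:
  "poly (map_poly of_int (p * q)) (x :: complex) =
   poly (map_poly of_int p) x * poly (map_poly of_int q) x"
proof -
  have "map_poly (of_int :: int \<Rightarrow> complex) (p * q) = map_poly of_int p * map_poly of_int q"
    by (rule poly_eqI) (simp add: coeff_map_poly coeff_mult)
  thus ?thesis by simp
qed

lemma ipoly_add:
  "poly (map_poly of_int (p + q)) (x :: complex) =
   poly (map_poly of_int p) x + poly (map_poly of_int q) x"
proof -
  have "map_poly (of_int :: int \<Rightarrow> complex) (p + q) = map_poly of_int p + map_poly of_int q"
    by (rule poly_eqI) (simp add: coeff_map_poly)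
  thus ?thesis by simp
qed

lemma is_min_int_poly_exists:
  assumes "algebraic \<beta>"
  shows "\<exists>M. is_min_int_poly M \<beta>"
proof -
  obtain p :: "int poly" where "p \<noteq> 0" "poly (map_poly of_int p) \<beta> = 0"
    using assms by (rule algebraicE')
  thus ?thesis
  proof (induction p rule: prime_divisors_induct)
    case (unit u)
    then obtain c where "u = [:c:]" "c dvd 1"
      by (auto simp: is_unit_poly_iff)
    thus ?case using unit by (auto simp: map_poly_pCons)
  next
    case (factor q p)
    have "poly (map_poly of_int q) \<beta> = 0 \<or> poly (map_poly of_int p) \<beta> = 0"
      using factor(4) by (simp add: ipoly_mult)
    moreover have "irreducible q"
      using factor(1) by (simp add: prime_elem_imp_irreducible prime_imp_prime_elem)
    ultimately show ?case
      using factor by (auto simp: is_min_int_poly_def)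
  qed auto
qed

lemma is_min_int_poly_dvd:
  assumes "is_min_int_poly M \<beta>" "is_min_int_poly N \<beta>"
  shows "M dvd N"
proof -
  define Z where "Z p \<longleftrightarrow> p \<noteq> 0 \<and> poly (map_poly of_int p) \<beta> = 0" for p :: "int poly"
  have ZM: "Z M" and "Z N" and primeM: "prime_elem M"
    using assms by (auto simp: Z_def is_min_int_poly_def irreducible_imp_prime_elem)
  obtain p where p: "Z p" "\<And>q. Z q \<Longrightarrow> degree p \<le> degree q"
    using ex_has_least_nat[of Z M degree] ZM by blast
  have not_const: "\<not> M dvd [:c:]" if "c \<noteq> 0" for c
  proof
    assume "M dvd [:c:]"
    then obtain r where "[:c:] = M * r" by (elim dvdE)
    hence "poly (map_poly of_int [:c:]) \<beta> = 0"
      using ZM by (simp only: ipoly_mult Z_def) simp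
    thus False using that by (simp add: map_poly_pCons)
  qed
  have p_multiple: "\<exists>a q. a \<noteq> 0 \<and> [:a:] * f = p * q" if "Z f" for f
  proof -
    have "p \<noteq> 0" using p(1) by (simp add: Z_def)
    then obtain a q where aq: "a \<noteq> 0" "smult a f = p * q + pseudo_mod f p"
      and r: "pseudo_mod f p = 0 \<or> degree (pseudo_mod f p) < degree p"
      using pseudo_mod[of p f] by blast
    have "poly (map_poly of_int ([:a:] * f)) \<beta> = 0"
      using that by (simp only: ipoly_mult Z_def) simp
    moreover have "[:a:] * f = p * q + pseudo_mod f p"
      using aq(2) by simp
    moreover have "poly (map_poly of_int p) \<beta> = 0"
      using p(1) by (simp add: Z_def)
    ultimately have "poly (map_poly of_int (pseudo_mod f p)) \<beta> = 0"
      by (simp only: ipoly_mult ipoly_add) simp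
    hence "pseudo_mod f p = 0"
      using r p(2)[of "pseudo_mod f p"] by (meson Z_def not_le)
    thus ?thesis using aq by auto
  qed
  have "M dvd p"
  proof -
    obtain a q where aq: "a \<noteq> 0" "[:a:] * M = p * q"
      using p_multiple[OF ZM] by blast
    have "M dvd p * q" by (metis aq(2) dvd_triv_right)
    moreover have "\<not> M dvd q"
    proof
      assume "M dvd q"
      then obtain r where "q = M * r" by (elim dvdE)
      hence "M * [:a:] = M * (p * r)" using aq(2) by (simp only: mult_ac)
      hence "[:a:] = p * r" using ZM by (simp only: mult_cancel_left Z_def) auto
      hence "poly (map_poly of_int [:a:]) \<beta> = 0"
        using p(1) by (simp only: ipoly_mult Z_def) simp
      thus False using aq(1) by (simp add: map_poly_pCons)
    qed
    ultimately show ?thesis using primeM prime_elem_dvd_multD by blast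
  qed
  moreover obtain a q where aq: "a \<noteq> 0" "[:a:] * N = p * q"
    using p_multiple[OF \<open>Z N\<close>] by blast
  ultimately have "M dvd [:a:] * N" by simp
  thus ?thesis
    using primeM not_const[OF aq(1)] prime_elem_dvd_multD by blast
qed

lemma is_min_int_poly_unique:
  assumes "is_min_int_poly M \<beta>" "is_min_int_poly N \<beta>"
  shows "N = M \<or> N = - M"
proof -
  have MN: "M dvd N" "N dvd M" "M \<noteq> 0"
    using assms is_min_int_poly_dvd by (auto simp: is_min_int_poly_def)
  then obtain u where u: "N = M * u" by (elim dvdE)
  have "u dvd 1"
  proof -
    have "M * u dvd M * 1" using MN u by simp
    thus ?thesis using MN(3) by (simp only: dvd_mult_cancel_left) simp
  qed
  then obtain c where "u = [:c:]" "c dvd 1" by (auto simp: is_unit_poly_iff)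
  moreover have "c = 1 \<or> c = -1" using \<open>c dvd 1\<close> by (auto simp: abs_if split: if_splits)
  ultimately show ?thesis using u by auto
qed

lemma poly_height_min_int_poly:
  assumes "is_min_int_poly M \<beta>"
  shows "poly_height (min_int_poly \<beta>) = poly_height M"
proof -
  have "is_min_int_poly (min_int_poly \<beta>) \<beta>"
    unfolding min_int_poly_def using assms by (rule someI)
  hence "min_int_poly \<beta> = M \<or> min_int_poly \<beta> = - M"
    using assms is_min_int_poly_unique by blast
  thus ?thesis by (auto simp: poly_height_def)
qed

end

theory Submission
  imports Defs
begin

text \<open>
  Put \<open>\<gamma> = f(\<alpha>)\<close> and let \<open>\<beta>\<^sub>n\<close> be the partial sum of \<open>f(\<alpha>)\<close> up to the index \<open>s\<^sub>n\<close>. The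
  coefficients vanish strictly between \<open>s\<^sub>n\<close> and \<open>t\<^sub>n\<close>, so \<open>\<bar>\<gamma> - \<beta>\<^sub>n\<bar>\<close> is of order \<open>\<bar>\<alpha>\<bar>\<close> to
  the power \<open>t\<^sub>n\<close>, whereas the arithmetic complexity of \<open>\<beta>\<^sub>n \<in> \<int>[\<alpha>]\<close> grows only
  exponentially in \<open>s\<^sub>n\<close>. Since \<open>t\<^sub>n / s\<^sub>n \<rightarrow> \<infinity>\<close>, the \<open>\<beta>\<^sub>n\<close> are approximations of Liouville
  quality.

  Complexity is measured without conjugates or norms. An element of \<open>\<int>[\<alpha>]\<close> is written as an
  integer combination of \<open>1, \<alpha>, \<dots>, \<alpha>\<^bsup>d-1\<^esup>\<close>, and its size is the sum of the absolute values of
  the coefficients. Sizes are controlled under sums and products, and the pigeonhole principle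
  yields, for every element \<open>y\<close> of small size, a non-zero integer polynomial of degree at most \<open>d\<close>
  with small coefficients that vanishes at \<open>y\<close> (\<open>small_relation\<close>). This one relation gives both
  estimates that are required: \<open>y\<close> cannot be too close to \<open>0\<close> unless it is \<open>0\<close>
  (\<open>liouville_lower_bound\<close>), and its minimal polynomial, a divisor of the relation, has small
  height (\<open>poly_height_bound\<close>).

  Suppose first that \<open>\<beta>\<^sub>n\<close> is not eventually constant. If \<open>\<gamma>\<close> were a root of an integer
  polynomial \<open>p\<close>, then \<open>p(\<beta>\<^sub>n)\<close> would be too small to be non-zero for large \<open>n\<close>, so \<open>\<beta>\<^sub>n\<close> would
  eventually run through the finitely many roots of \<open>p\<close> and, being convergent, stop. Hence \<open>\<gamma>\<close>
  is transcendental (\<open>transcendental\<close>). A rational \<open>\<beta>\<^sub>n\<close> is an integer, and a limit of integers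
  is an integer, so \<open>\<beta>\<^sub>n\<close> is irrational for large \<open>n\<close>; as \<open>\<alpha>\<close> is simple, \<open>\<beta>\<^sub>n\<close> then generates
  \<open>\<rat>(\<alpha>)\<close> and has degree \<open>m\<close> (\<open>eventually_same_degree\<close>). So the \<open>\<beta>\<^sub>n\<close> witness the defining
  property of \<open>U\<^sub>m\<close> (\<open>U_approx_if_degree\<close>). A number \<open>x\<close> of degree \<open>k < m\<close> keeps away from all
  these \<open>\<beta>\<^sub>n\<close>, because its minimal polynomial does not vanish at a number of degree \<open>m\<close>. Since
  \<open>s\<^bsub>n+1\<^esub> / t\<^sub>n\<close> is bounded, there is always an \<open>n\<close> for which \<open>\<beta>\<^sub>n\<close> is closer to \<open>\<gamma>\<close> than to
  \<open>x\<close> and whose complexity is comparable to that of \<open>x\<close>; so \<open>x\<close> keeps away from \<open>\<gamma>\<close> by a fixed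
  negative power of its height (\<open>not_U_approx_below_degree\<close>).

  If \<open>\<beta>\<^sub>n\<close> is eventually constant, then \<open>\<alpha>\<close> is a root of a non-zero block of the series, a
  polynomial whose coefficients are bounded by \<open>A\<close>. Its divisor, the minimal polynomial of \<open>\<alpha>\<close>,
  has degree at most \<open>m\<close> and hence lies in a finite set of polynomials. These are the exceptions.
\<close>

section \<open>Integer polynomials and the degree of an algebraic number\<close>

interpretation rat_space: vector_space rat_scale
  by (rule vector_space_rat_scale)

abbreviation ipoly :: "int poly \<Rightarrow> complex \<Rightarrow> complex" where
  "ipoly p x \<equiv> poly (map_poly of_int p) x"

lemma ipoly_altdef:
  assumes "degree p \<le> n"
  shows "ipoly p x = (\<Sum>i\<le>n. of_int (coeff p i) * x ^ i)"
proof -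
  have "ipoly p x = (\<Sum>i\<le>degree p. of_int (coeff p i) * x ^ i)"
    by (simp add: poly_altdef coeff_map_poly degree_map_poly)
  also have "\<dots> = (\<Sum>i\<le>n. of_int (coeff p i) * x ^ i)"
    by (rule sum.mono_neutral_left) (use assms in \<open>auto simp: coeff_eq_0\<close>)
  finally show ?thesis .
qed

lemma ipoly_of_coeffs:
  fixes c :: "nat \<Rightarrow> int"
  obtains p where "\<And>i. coeff p i = (if i \<le> n then c i else 0)" "degree p \<le> n"
    "\<And>x. ipoly p x = (\<Sum>i\<le>n. of_int (c i) * x ^ i)"
proof -
  define p where "p = (\<Sum>i\<le>n. monom (c i) i)"
  have co: "coeff p i = (if i \<le> n then c i else 0)" for i
    by (simp add: p_def coeff_sum)
  have deg: "degree p \<le> n"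
    by (rule degree_le) (simp add: co)
  have "ipoly p x = (\<Sum>i\<le>n. of_int (c i) * x ^ i)" for x
    by (simp add: ipoly_altdef[OF deg] co)
  thus ?thesis using that co deg by blast
qed

text \<open>
  Some prime factor of \<open>p\<close> vanishes at \<open>x\<close>; it is again a minimal polynomial of \<open>x\<close> and so
  associated to \<open>M\<close>. Divisibility thus holds in \<open>\<int>[T]\<close>, with no denominators to control.
\<close>
lemma is_min_int_poly_dvd_annihilator:
  assumes M: "is_min_int_poly M x" and p: "ipoly p x = 0"
  shows "M dvd p"
  using p
proof (induction p rule: prime_divisors_induct)
  case (unit u)
  then obtain c where "u = [:c:]" "c dvd 1"
    by (auto simp: is_unit_poly_iff)
  thus ?case using unit by (auto simp: map_poly_pCons)
next
  case (factor q p)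
  have "ipoly q x = 0 \<or> ipoly p x = 0"
    using factor.prems by (simp add: ipoly_mult)
  thus ?case
  proof
    assume "ipoly q x = 0"
    hence "is_min_int_poly q x"
      using factor by (simp add: is_min_int_poly_def prime_elem_imp_irreducible prime_imp_prime_elem)
    thus ?thesis using is_min_int_poly_dvd[OF M] by simp
  qed (use factor.IH in simp)
qed auto

lemma is_min_int_poly_nonzero: "is_min_int_poly M x \<Longrightarrow> M \<noteq> 0"
  by (auto simp: is_min_int_poly_def)

lemma is_min_int_poly_degree_pos:
  assumes "is_min_int_poly M x"
  shows "degree M > 0"
proof (rule ccontr)
  assume "\<not> degree M > 0"
  then obtain c where c: "M = [:c:]"
    using degree_eq_zeroE by blast
  thus False using assms by (auto simp: is_min_int_poly_def map_poly_pCons)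
qed

lemma is_min_int_poly_degree_le:
  assumes "is_min_int_poly M x" "p \<noteq> 0" "ipoly p x = 0"
  shows "degree M \<le> degree p"
  using assms is_min_int_poly_dvd_annihilator dvd_imp_degree_le by blast

lemma rat_common_denominator:
  fixes c :: "nat \<Rightarrow> rat"
  obtains D :: int and k where "D > 0" "\<And>i. i \<le> n \<Longrightarrow> of_int D * c i = of_int (k i)"
proof -
  define D where "D = (\<Prod>i\<le>n. snd (quotient_of (c i)))"
  have pos: "D > 0"
    unfolding D_def by (rule prod_pos) (simp add: quotient_of_denom_pos')
  have "\<exists>k::int. of_int D * c i = of_int k" if i: "i \<le> n" for i
  proof -
    obtain a b where ab: "quotient_of (c i) = (a, b)" by fastforce
    have "b dvd D" using i ab unfolding D_def by (metis atMost_iff dvd_prodI finite_atMost snd_conv)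
    then obtain e where e: "D = b * e" by (elim dvdE)
    have "b > 0" using quotient_of_denom_pos[OF ab] .
    have "of_int D * c i = of_int (a * e)"
      using quotient_of_div[OF ab] \<open>b > 0\<close> by (simp add: e)
    thus ?thesis by blast
  qed
  then obtain k where "\<And>i. i \<le> n \<Longrightarrow> of_int D * c i = of_int (k i)" by metis
  with pos show ?thesis using that by blast
qed

text \<open>
  Linear dependence is stated for families instead of sets, so that repeated members count: they
  give the relation with coefficients \<open>1\<close> and \<open>-1\<close>.
\<close>
lemma rat_relation_if_span_small:
  fixes v :: "nat \<Rightarrow> complex"
  assumes T: "finite T" "card T \<le> n" and v: "\<And>i. i \<le> n \<Longrightarrow> v i \<in> rat_space.span T"
  obtains c :: "nat \<Rightarrow> rat" where "\<exists>i\<le>n. c i \<noteq> 0" "(\<Sum>i\<le>n. of_rat (c i) * v i) = 0"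
proof (cases "inj_on v {..n}")
  case False
  then obtain i j where ij: "i \<le> n" "j \<le> n" "i \<noteq> j" "v i = v j"
    by (auto simp: inj_on_def)
  define c :: "nat \<Rightarrow> rat" where "c = (\<lambda>k. if k = i then 1 else if k = j then -1 else 0)"
  have "(\<Sum>k\<le>n. of_rat (c k) * v k) = (\<Sum>k\<in>{i, j}. of_rat (c k) * v k)"
    by (rule sum.mono_neutral_right) (use ij in \<open>auto simp: c_def\<close>)
  also have "\<dots> = 0" using ij by (simp add: c_def of_rat_minus)
  finally have "(\<Sum>k\<le>n. of_rat (c k) * v k) = 0" .
  moreover have "\<exists>k\<le>n. c k \<noteq> 0" using ij by (auto simp: c_def)
  ultimately show ?thesis using that by blast
next
  case True
  have "rat_space.dependent (v ` {..n})"
  proof (rule ccontr)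
    assume "\<not> rat_space.dependent (v ` {..n})"
    hence "card (v ` {..n}) \<le> card T"
      using rat_space.independent_span_bound[OF T(1)] v by blast
    thus False using True T(2) by (simp add: card_image)
  qed
  then obtain u where u: "(\<Sum>w\<in>v ` {..n}. rat_scale (u w) w) = 0" "\<exists>w\<in>v ` {..n}. u w \<noteq> 0"
    using rat_space.dependent_finite[of "v ` {..n}"] by auto
  have "(\<Sum>i\<le>n. of_rat (u (v i)) * v i) = 0"
    using u(1) True by (simp add: sum.reindex rat_scale_def)
  thus ?thesis using u(2) that[of "u \<circ> v"] by auto
qed

lemma complex_subfield_rat_adjoin: "complex_subfield (rat_adjoin x)"
  unfolding rat_adjoin_def complex_subfield_def by blast

lemma in_rat_adjoin: "x \<in> rat_adjoin x"
  by (auto simp: rat_adjoin_def)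

lemma rat_adjoin_minimal: "complex_subfield K \<Longrightarrow> x \<in> K \<Longrightarrow> rat_adjoin x \<subseteq> K"
  by (auto simp: rat_adjoin_def)

lemma
  assumes K: "complex_subfield K"
  shows complex_subfield_0: "0 \<in> K"
    and complex_subfield_1: "1 \<in> K"
    and complex_subfield_diff: "\<And>x y. x \<in> K \<Longrightarrow> y \<in> K \<Longrightarrow> x - y \<in> K"
    and complex_subfield_mult: "\<And>x y. x \<in> K \<Longrightarrow> y \<in> K \<Longrightarrow> x * y \<in> K"
    and complex_subfield_inverse: "\<And>x. x \<in> K \<Longrightarrow> inverse x \<in> K"
    and complex_subfield_add: "\<And>x y. x \<in> K \<Longrightarrow> y \<in> K \<Longrightarrow> x + y \<in> K"
proof -
  show d: "x - y \<in> K" if "x \<in> K" "y \<in> K" for x y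
    using K that by (auto simp: complex_subfield_def)
  show 1: "1 \<in> K" using K by (auto simp: complex_subfield_def)
  show 0: "0 \<in> K" using d[OF 1 1] by simp
  show "x + y \<in> K" if "x \<in> K" "y \<in> K" for x y
    using d[OF that(1) d[OF 0 that(2)]] by simp
qed (use K in \<open>auto simp: complex_subfield_def\<close>)

lemma complex_subfield_power: "complex_subfield K \<Longrightarrow> x \<in> K \<Longrightarrow> x ^ n \<in> K"
  by (induction n) (auto simp: complex_subfield_1 complex_subfield_mult)

lemma complex_subfield_of_int: "complex_subfield K \<Longrightarrow> of_int n \<in> K"
proof (induction n rule: int_induct[where k = 0])
qed (auto simp: complex_subfield_0 complex_subfield_1 complex_subfield_add complex_subfield_diff)

lemma complex_subfield_sum:
  "complex_subfield K \<Longrightarrow> (\<And>i. i \<in> I \<Longrightarrow> g i \<in> K) \<Longrightarrow> sum g I \<in> K"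
  by (induction I rule: infinite_finite_induct)
     (auto simp: complex_subfield_0 complex_subfield_add)

lemma ipoly_if_rat_relation:
  fixes c :: "nat \<Rightarrow> rat"
  assumes "\<exists>i\<le>n. c i \<noteq> 0" "(\<Sum>i\<le>n. of_rat (c i) * x ^ i) = 0"
  obtains p where "p \<noteq> 0" "degree p \<le> n" "ipoly p x = 0"
proof -
  obtain D k where D: "D > 0" "\<And>i. i \<le> n \<Longrightarrow> of_int D * c i = of_int (k i)"
    by (rule rat_common_denominator[of n c]) blast
  have D': "of_int (k i) = (of_int D * of_rat (c i) :: complex)" if "i \<le> n" for i
    using arg_cong[OF D(2)[OF that], of "of_rat :: rat \<Rightarrow> complex"] by (simp add: of_rat_mult)
  obtain p where p: "\<And>i. coeff p i = (if i \<le> n then k i else 0)" "degree p \<le> n"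
    "\<And>x. ipoly p x = (\<Sum>i\<le>n. of_int (k i) * x ^ i)"
    using ipoly_of_coeffs[of n k] by blast
  have "ipoly p x = of_int D * (\<Sum>i\<le>n. of_rat (c i) * x ^ i)"
    by (simp add: p(3) D' sum_distrib_left mult.assoc)
  hence "ipoly p x = 0" using assms(2) by simp
  moreover obtain i where "i \<le> n" "c i \<noteq> 0" using assms(1) by blast
  hence "k i \<noteq> 0" using D(1) D(2)[of i] by auto
  hence "p \<noteq> 0" using p(1)[of i] \<open>i \<le> n\<close> by auto
  ultimately show ?thesis using that p(2) by blast
qed

text \<open>
  A dimension that is positive is the cardinality of a finite basis. With \<open>m\<close> basis elements, the
  \<open>m + 1\<close> powers \<open>1, x, \<dots>, x\<^sup>m\<close> satisfy a rational relation.
\<close>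
lemma degree_min_int_poly_le_alg_degree:
  assumes M: "is_min_int_poly M x" and pos: "alg_degree x > 0"
  shows "degree M \<le> alg_degree x"
proof -
  obtain B where B: "rat_adjoin x \<subseteq> rat_space.span B" "card B = alg_degree x"
    using rat_space.basis_exists[of "rat_adjoin x"] unfolding alg_degree_def by blast
  have "finite B" using B(2) pos card_ge_0_finite by metis
  moreover have "x ^ i \<in> rat_space.span B" for i
    using B(1) complex_subfield_power[OF complex_subfield_rat_adjoin in_rat_adjoin] by blast
  ultimately obtain c :: "nat \<Rightarrow> rat" where
    "\<exists>i\<le>alg_degree x. c i \<noteq> 0" "(\<Sum>i\<le>alg_degree x. of_rat (c i) * x ^ i) = 0"
    using rat_relation_if_span_small[of B "alg_degree x" "\<lambda>i. x ^ i"] B(2) order_refl by metis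
  then obtain p where "p \<noteq> 0" "degree p \<le> alg_degree x" "ipoly p x = 0"
    using ipoly_if_rat_relation by blast
  thus ?thesis using is_min_int_poly_degree_le[OF M] by fastforce
qed

text \<open>
  The rational span of \<open>1, x, \<dots>, x\<^bsup>d-1\<^esup>\<close> is a field and therefore contains \<open>\<rat>(x)\<close>. Closure under
  multiplication reduces to \<open>x\<^sup>d\<close>. For inverses, the powers of \<open>y\<close> lie in a space of dimension at
  most \<open>d\<close>, so they are related, and dividing a relation by its lowest term expresses the inverse
  of \<open>y\<close> as a polynomial in \<open>y\<close>.
\<close>
lemma alg_degree_le_degree:
  assumes p: "p \<noteq> 0" "ipoly p x = 0"
  shows "alg_degree x \<le> degree p"
proof -
  define d where "d = degree p"
  define T where "T = (\<lambda>i. x ^ i) ` {..<d}"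
  define K where "K = rat_space.span T"
  have T: "finite T" "card T \<le> d"
    using card_image_le[of "{..<d}" "\<lambda>i. x ^ i"] by (auto simp: T_def)
  have scale: "of_rat q * y \<in> K" if "y \<in> K" for q y
    using rat_space.span_scale[of y T q] that by (simp add: K_def rat_scale_def)
  have K_sum: "(\<And>i. i \<in> I \<Longrightarrow> g i \<in> K) \<Longrightarrow> sum g I \<in> K" for g :: "nat \<Rightarrow> complex" and I
    using rat_space.span_sum[of I g T] by (simp add: K_def)
  have low: "x ^ i \<in> K" if "i < d" for i
    using that by (auto simp: K_def T_def intro: rat_space.span_base)
  have "d > 0"
  proof (rule ccontr)
    assume "\<not> d > 0"
    then obtain c where "p = [:c:]" unfolding d_def using degree_eq_zeroE by blast
    thus False using p by (auto simp: map_poly_pCons)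
  qed
  have top: "x ^ d \<in> K"
  proof -
    have "ipoly p x = (\<Sum>i<Suc d. of_int (coeff p i) * x ^ i)"
      using ipoly_altdef[of p d x] by (simp add: d_def lessThan_Suc_atMost)
    hence "of_int (coeff p d) * x ^ d = - (\<Sum>i<d. of_int (coeff p i) * x ^ i)"
      using p(2) by (simp add: add_eq_0_iff)
    moreover have lc: "coeff p d \<noteq> 0" using p(1) by (simp add: d_def)
    ultimately have "x ^ d = (- (\<Sum>i<d. of_int (coeff p i) * x ^ i)) / of_int (coeff p d)"
      by (metis nonzero_mult_div_cancel_left of_int_eq_0_iff)
    also have "\<dots> = of_rat (- 1 / of_int (coeff p d)) * (\<Sum>i<d. of_rat (of_int (coeff p i)) * x ^ i)"
      by (simp add: of_rat_divide of_rat_minus)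
    also have "\<dots> \<in> K"
      by (intro scale K_sum low) auto
    finally show ?thesis .
  qed
  have x_mult: "x * y \<in> K" if "y \<in> K" for y
    using that unfolding K_def
  proof (induction rule: rat_space.span_induct_alt)
    case base
    show ?case by (simp add: rat_space.span_zero)
  next
    case (step c w y)
    then obtain i where i: "i < d" "w = x ^ i" by (auto simp: T_def)
    have "x ^ Suc i \<in> K" using low[of "Suc i"] top i by (cases "Suc i = d") auto
    hence "rat_scale c (x ^ Suc i) + x * y \<in> rat_space.span T"
      using step by (intro rat_space.span_add rat_space.span_scale) (auto simp: K_def)
    moreover have "x * (rat_scale c w + y) = rat_scale c (x ^ Suc i) + x * y"
      by (simp add: i rat_scale_def algebra_simps)
    ultimately show ?case by (simp only: )
  qed
  have pow_mult: "x ^ i * y \<in> K" if "y \<in> K" for i y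
    by (induction i) (use that x_mult in \<open>auto simp: mult.assoc\<close>)
  have mult: "z * y \<in> K" if "z \<in> K" "y \<in> K" for z y
    using that(1) unfolding K_def
  proof (induction rule: rat_space.span_induct_alt)
    case base
    show ?case by (simp add: rat_space.span_zero)
  next
    case (step c w z)
    then obtain i where i: "i < d" "w = x ^ i" by (auto simp: T_def)
    have "rat_scale c (x ^ i * y) + z * y \<in> rat_space.span T"
      using step pow_mult[OF that(2)] by (intro rat_space.span_add rat_space.span_scale) (auto simp: K_def)
    moreover have "(rat_scale c w + z) * y = rat_scale c (x ^ i * y) + z * y"
      by (simp add: i rat_scale_def algebra_simps)
    ultimately show ?case by (simp only: )
  qed
  have one: "1 \<in> K" using low[of 0] \<open>d > 0\<close> by simp
  have pow: "y ^ i \<in> K" if "y \<in> K" for y i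
    by (induction i) (use that one mult in auto)
  have inv: "inverse y \<in> K" if y: "y \<in> K" for y
  proof (cases "y = 0")
    case True
    thus ?thesis using that by simp
  next
    case False
    obtain c :: "nat \<Rightarrow> rat" where c: "\<exists>i\<le>d. c i \<noteq> 0" "(\<Sum>i\<le>d. of_rat (c i) * y ^ i) = 0"
      using rat_relation_if_span_small[OF T, of "\<lambda>i. y ^ i"] pow[OF y] unfolding K_def by blast
    define j where "j = (LEAST i. i \<le> d \<and> c i \<noteq> 0)"
    have j: "j \<le> d" "c j \<noteq> 0"
      using LeastI_ex[of "\<lambda>i. i \<le> d \<and> c i \<noteq> 0"] c(1) unfolding j_def by auto
    have below: "c i = 0" if "i < j" for i
      using not_less_Least[of i "\<lambda>i. i \<le> d \<and> c i \<noteq> 0"] that j(1) unfolding j_def by auto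
    have "0 = (\<Sum>i\<in>{j..d}. of_rat (c i) * y ^ i)"
      unfolding c(2)[symmetric] by (rule sum.mono_neutral_right) (auto simp: below)
    also have "\<dots> = of_rat (c j) * y ^ j + (\<Sum>i\<in>{Suc j..d}. of_rat (c i) * y ^ i)"
      using j(1) by (simp add: sum.atLeast_Suc_atMost)
    also have "(\<Sum>i\<in>{Suc j..d}. of_rat (c i) * y ^ i)
        = y ^ Suc j * (\<Sum>i\<in>{Suc j..d}. of_rat (c i) * y ^ (i - Suc j))"
      by (simp add: sum_distrib_left mult.left_commute flip: power_add power_Suc)
    finally have "y ^ j * (of_rat (c j) + y * (\<Sum>i\<in>{Suc j..d}. of_rat (c i) * y ^ (i - Suc j))) = 0"
      by (simp add: algebra_simps)
    hence "y * (\<Sum>i\<in>{Suc j..d}. of_rat (c i) * y ^ (i - Suc j)) = - of_rat (c j)"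
      using False by (simp add: add_eq_0_iff)
    hence "of_rat (- inverse (c j)) * (y * (\<Sum>i\<in>{Suc j..d}. of_rat (c i) * y ^ (i - Suc j))) = 1"
      using j(2) by (simp add: of_rat_minus of_rat_inverse)
    hence "y * (of_rat (- inverse (c j)) * (\<Sum>i\<in>{Suc j..d}. of_rat (c i) * y ^ (i - Suc j))) = 1"
      by (simp only: mult.left_commute)
    hence "inverse y = of_rat (- inverse (c j)) * (\<Sum>i\<in>{Suc j..d}. of_rat (c i) * y ^ (i - Suc j))"
      by (rule inverse_unique)
    also have "\<dots> \<in> K" by (intro scale K_sum pow y)
    finally show ?thesis .
  qed
  have diff: "y - z \<in> K" if "y \<in> K" "z \<in> K" for y z
    using rat_space.span_diff that unfolding K_def by blast
  have "complex_subfield K"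
    unfolding complex_subfield_def using one mult inv diff by blast
  moreover have "x \<in> K" using x_mult[OF one] by simp
  ultimately have "rat_adjoin x \<subseteq> K" by (rule rat_adjoin_minimal)
  hence "alg_degree x \<le> card T"
    unfolding alg_degree_def K_def by (rule rat_space.dim_le_card) (rule T)
  thus ?thesis using T(2) by (simp add: d_def)
qed

section \<open>Roots and divisors of integer polynomials of bounded height\<close>

lemma finite_bounded_int_polys:
  "finite {p :: int poly. degree p \<le> d \<and> (\<forall>i. \<bar>coeff p i\<bar> \<le> B)}"
proof (rule finite_subset)
  show "{p :: int poly. degree p \<le> d \<and> (\<forall>i. \<bar>coeff p i\<bar> \<le> B)}
      \<subseteq> Poly ` {xs. set xs \<subseteq> {-B..B} \<and> length xs \<le> Suc d}"
  proof
    fix p :: "int poly"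
    assume "p \<in> {p. degree p \<le> d \<and> (\<forall>i. \<bar>coeff p i\<bar> \<le> B)}"
    hence p: "degree p \<le> d" "\<And>i. \<bar>coeff p i\<bar> \<le> B" by auto
    have "set (coeffs p) \<subseteq> {-B..B}"
    proof
      fix x assume "x \<in> set (coeffs p)"
      then obtain i where "x = coeff p i"
        by (auto simp: coeffs_def split: if_splits)
      thus "x \<in> {-B..B}" using p(2)[of i] by auto
    qed
    moreover have "length (coeffs p) \<le> Suc d"
      using p(1) by (auto simp: coeffs_def)
    ultimately show "p \<in> Poly ` {xs. set xs \<subseteq> {-B..B} \<and> length xs \<le> Suc d}"
      by (intro image_eqI[of _ _ "coeffs p"]) auto
  qed
qed (intro finite_imageI finite_lists_length_le, simp)

lemma finite_roots_of_bounded_int_polys: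
  "finite {x. \<exists>p. p \<noteq> 0 \<and> degree p \<le> d \<and> (\<forall>i. \<bar>coeff p i\<bar> \<le> B) \<and> ipoly p x = 0}"
proof (rule finite_subset)
  let ?S = "{p :: int poly. degree p \<le> d \<and> (\<forall>i. \<bar>coeff p i\<bar> \<le> B)} - {0}"
  show "{x. \<exists>p. p \<noteq> 0 \<and> degree p \<le> d \<and> (\<forall>i. \<bar>coeff p i\<bar> \<le> B) \<and> ipoly p x = 0}
      \<subseteq> (\<Union>p\<in>?S. {x. ipoly p x = 0})"
    by blast
  have "finite {x. ipoly p x = 0}" if "p \<noteq> 0" for p
    by (rule poly_roots_finite) (use that in \<open>simp add: map_poly_eq_0_iff\<close>)
  thus "finite (\<Union>p\<in>?S. {x. ipoly p x = 0})"
    using finite_bounded_int_polys[of d B] by blast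
qed

text \<open>
  A larger root would make the leading term, whose coefficient is a non-zero integer, dominate the
  sum of all others.
\<close>
lemma ipoly_root_bound:
  fixes N :: nat
  assumes p: "p \<noteq> 0" "ipoly p x = 0" and bound: "\<And>i. \<bar>coeff p i\<bar> \<le> int N"
  shows "cmod x \<le> real N + 1"
proof (rule ccontr)
  assume "\<not> cmod x \<le> real N + 1"
  hence big: "cmod x > real N + 1" by simp
  define n where "n = degree p"
  have lc: "coeff p n \<noteq> 0" using p(1) by (simp add: n_def)
  have "ipoly p x = (\<Sum>i<n. of_int (coeff p i) * x ^ i) + of_int (coeff p n) * x ^ n"
    using ipoly_altdef[of p n x] by (simp add: n_def flip: lessThan_Suc_atMost)
  hence eq: "of_int (coeff p n) * x ^ n = - (\<Sum>i<n. of_int (coeff p i) * x ^ i)"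
    using p(2) by (simp add: add_eq_0_iff)
  have coeff_le: "cmod (of_int (coeff p i)) \<le> real N" for i
    using bound[of i] by (simp flip: of_int_abs)
  have "1 \<le> cmod (of_int (coeff p n))"
    using lc by (simp flip: of_int_abs)
  hence "cmod x ^ n \<le> cmod (of_int (coeff p n)) * cmod x ^ n"
    by (simp add: mult_le_cancel_right1)
  also have "\<dots> = cmod (\<Sum>i<n. of_int (coeff p i) * x ^ i)"
    using arg_cong[OF eq, of cmod] by (simp add: norm_mult norm_power)
  also have "\<dots> \<le> (\<Sum>i<n. real N * cmod x ^ i)"
    by (rule sum_norm_le) (use coeff_le in \<open>auto simp: norm_mult norm_power intro!: mult_right_mono\<close>)
  also have "\<dots> = real N * (\<Sum>i<n. cmod x ^ i)"
    by (simp add: sum_distrib_left)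
  also have "\<dots> \<le> (cmod x - 1) * (\<Sum>i<n. cmod x ^ i)"
    by (rule mult_right_mono) (use big in \<open>auto intro!: sum_nonneg\<close>)
  also have "\<dots> = cmod x ^ n - 1"
    by (simp add: power_diff_1_eq)
  finally show False by simp
qed

lemma coeff_prod_linear_bound:
  fixes A :: "complex multiset"
  assumes "\<And>x. x \<in># A \<Longrightarrow> cmod x \<le> R" "R \<ge> 0"
  shows "cmod (coeff (\<Prod>x\<in>#A. [:- x, 1:]) i) \<le> (1 + R) ^ size A"
  using assms(1)
proof (induction A arbitrary: i)
  case empty
  show ?case by simp
next
  case (add x A)
  define p where "p = (\<Prod>x\<in>#A. [:- x, 1:])"
  have IH: "cmod (coeff p j) \<le> (1 + R) ^ size A" for j
    unfolding p_def using add by simp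
  have x: "cmod x \<le> R" using add.prems by simp
  have "coeff ([:- x, 1:] * p) i = - x * coeff p i + (if i = 0 then 0 else coeff p (i - 1))"
    by (cases i) (simp_all add: coeff_pCons)
  also have "cmod \<dots> \<le> R * (1 + R) ^ size A + (1 + R) ^ size A"
  proof (rule order.trans[OF norm_triangle_ineq] add_mono)+
    show "cmod (- x * coeff p i) \<le> R * (1 + R) ^ size A"
      unfolding norm_mult by (rule mult_mono) (use x IH assms(2) in auto)
    show "cmod (if i = 0 then 0 else coeff p (i - 1)) \<le> (1 + R) ^ size A"
      using IH[of "i - 1"] assms(2) by simp
  qed
  finally show ?case by (simp add: p_def algebra_simps)
qed

text \<open>
  The roots of \<open>M\<close> are roots of \<open>p\<close> and its leading coefficient divides that of \<open>p\<close>; both are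
  therefore bounded, and they determine \<open>M\<close>.
\<close>
lemma coeff_bound_divisor:
  fixes N :: nat
  assumes "M dvd p" "p \<noteq> 0" and bound: "\<And>i. \<bar>coeff p i\<bar> \<le> int N"
  shows "\<bar>coeff M i\<bar> \<le> int (N * (N + 2) ^ degree M)"
proof -
  define Mc :: "complex poly" where "Mc = map_poly of_int M"
  have "M \<noteq> 0" using assms by auto
  have deg: "degree Mc = degree M" by (simp add: Mc_def degree_map_poly)
  have "Mc \<noteq> 0" using \<open>M \<noteq> 0\<close> by (simp add: Mc_def map_poly_eq_0_iff)
  have root: "cmod x \<le> real N + 1" if "x \<in># proots Mc" for x
  proof -
    have "ipoly M x = 0" using that \<open>Mc \<noteq> 0\<close> by (simp add: Mc_def)
    hence "ipoly p x = 0" using assms(1) by (auto simp: ipoly_mult elim!: dvdE)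
    thus ?thesis using ipoly_root_bound assms(2) bound by blast
  qed
  obtain r where r: "p = M * r" using assms(1) by (elim dvdE)
  have "r \<noteq> 0" using r assms(2) by auto
  have "\<bar>lead_coeff M\<bar> \<le> \<bar>lead_coeff M\<bar> * \<bar>lead_coeff r\<bar>"
  proof -
    have "lead_coeff r \<noteq> 0" using \<open>r \<noteq> 0\<close> by simp
    hence "\<bar>lead_coeff r\<bar> \<ge> 1" by linarith
    thus ?thesis using mult_left_mono[of 1 "\<bar>lead_coeff r\<bar>" "\<bar>lead_coeff M\<bar>"] by simp
  qed
  also have "\<dots> = \<bar>lead_coeff p\<bar>" by (simp add: r lead_coeff_mult abs_mult)
  also have "\<dots> \<le> int N" using bound .
  finally have lc: "\<bar>lead_coeff M\<bar> \<le> int N" .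
  have "coeff Mc i = lead_coeff Mc * coeff (\<Prod>x\<in>#proots Mc. [:- x, 1:]) i"
    using arg_cong[OF complex_poly_decompose_multiset[of Mc], of "\<lambda>q. coeff q i"] by simp
  hence "cmod (coeff Mc i)
      = cmod (lead_coeff Mc) * cmod (coeff (\<Prod>x\<in>#proots Mc. [:- x, 1:]) i)"
    by (simp add: norm_mult)
  also have "\<dots> \<le> real N * (1 + (real N + 1)) ^ size (proots Mc)"
  proof (rule mult_mono)
    have "lead_coeff Mc = of_int (lead_coeff M)" by (simp add: deg) (simp add: Mc_def coeff_map_poly)
    thus "cmod (lead_coeff Mc) \<le> real N"
      using lc by (simp flip: of_int_abs)
  qed (use root coeff_prod_linear_bound[of "proots Mc" "real N + 1"] in auto)
  also have "size (proots Mc) = degree M" by (simp add: size_proots_complex deg)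
  also have "cmod (coeff Mc i) = real_of_int \<bar>coeff M i\<bar>"
    by (simp add: Mc_def coeff_map_poly)
  also have "real N * (1 + (real N + 1)) ^ degree M = real_of_int (int (N * (N + 2) ^ degree M))"
    by (simp add: add.commute)
  finally show ?thesis by (simp only: of_int_le_iff)
qed

lemma finite_poly_height_set: "finite {\<bar>coeff p i\<bar> |i. i \<le> degree p}"
proof -
  have "{\<bar>coeff p i\<bar> |i. i \<le> degree p} = (\<lambda>i. \<bar>coeff p i\<bar>) ` {..degree p}" by auto
  thus ?thesis by simp
qed

lemma coeff_le_poly_height: "\<bar>coeff p i\<bar> \<le> poly_height p"
proof (cases "i \<le> degree p")
  case True
  thus ?thesis unfolding poly_height_def by (intro Max_ge finite_poly_height_set) auto
next
  case False
  have "\<bar>coeff p 0\<bar> \<le> poly_height p"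
    unfolding poly_height_def by (intro Max_ge finite_poly_height_set) auto
  thus ?thesis using False by (simp add: coeff_eq_0)
qed

lemma poly_height_le: "(\<And>i. \<bar>coeff p i\<bar> \<le> B) \<Longrightarrow> poly_height p \<le> B"
  unfolding poly_height_def by (subst Max_le_iff[OF finite_poly_height_set]) auto

lemma poly_height_ge_1:
  assumes "p \<noteq> 0"
  shows "poly_height p \<ge> 1"
proof -
  have "coeff p (degree p) \<noteq> 0" using assms by simp
  thus ?thesis using coeff_le_poly_height[of p "degree p"] by linarith
qed

lemma is_min_int_poly_min_int_poly: "algebraic x \<Longrightarrow> is_min_int_poly (min_int_poly x) x"
  unfolding min_int_poly_def by (rule someI_ex) (rule is_min_int_poly_exists)

section \<open>Integer combinations of powers of an algebraic integer\<close>

text \<open>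
  A monic relation of degree \<open>d\<close> for \<open>\<alpha>\<close>. Multiplication by \<open>\<alpha>\<close> followed by a reduction with this
  relation enlarges coefficient sums at most by the factor \<open>K\<close>.
\<close>
locale integral_relation =
  fixes \<alpha> :: complex and d :: nat and e :: "nat \<Rightarrow> int" and K :: nat
  assumes d_pos: "d > 0"
    and relation: "\<alpha> ^ d = (\<Sum>i<d. of_int (e i) * \<alpha> ^ i)"
    and K_bound: "1 + (\<Sum>i<d. \<bar>e i\<bar>) \<le> int K"
begin

text \<open>
  The powers of \<open>\<alpha>\<close> may be dependent, so that a number can have many coefficient vectors; the
  predicate bounds the best of them.
\<close>
definition size_le :: "complex \<Rightarrow> nat \<Rightarrow> bool" where
  "size_le y X \<longleftrightarrow>
     (\<exists>r :: nat \<Rightarrow> int. y = (\<Sum>i<d. of_int (r i) * \<alpha> ^ i) \<and> (\<Sum>i<d. \<bar>r i\<bar>) \<le> int X)"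

lemma size_leE:
  assumes "size_le y X"
  obtains r :: "nat \<Rightarrow> int" where "y = (\<Sum>i<d. of_int (r i) * \<alpha> ^ i)" "(\<Sum>i<d. \<bar>r i\<bar>) \<le> int X"
  using assms by (auto simp: size_le_def)

lemma K_pos: "K \<ge> 1"
proof -
  have "(\<Sum>i<d. \<bar>e i\<bar>) \<ge> 0" by (intro sum_nonneg) simp
  thus ?thesis using K_bound by linarith
qed

lemma size_le_mono:
  assumes "size_le y X" "X \<le> Y"
  shows "size_le y Y"
proof -
  obtain r where r: "y = (\<Sum>i<d. of_int (r i) * \<alpha> ^ i)" "(\<Sum>i<d. \<bar>r i\<bar>) \<le> int X"
    using assms(1) by (rule size_leE)
  have "(\<Sum>i<d. \<bar>r i\<bar>) \<le> int Y" using r(2) assms(2) by linarith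
  with r(1) show ?thesis unfolding size_le_def by blast
qed

lemma size_le_0: "size_le 0 0"
  unfolding size_le_def by (rule exI[of _ "\<lambda>_. 0"]) simp

lemma size_le_1: "size_le 1 1"
proof -
  obtain d' where d': "d = Suc d'" using d_pos gr0_implies_Suc by blast
  have "1 = (\<Sum>i<d. of_int (if i = 0 then 1 else 0) * \<alpha> ^ i)"
    unfolding d' by (subst sum.lessThan_Suc_shift) simp
  moreover have "(\<Sum>i<d. \<bar>if i = 0 then 1 else 0\<bar>) \<le> int 1"
    unfolding d' by (subst sum.lessThan_Suc_shift) simp
  ultimately show ?thesis
    unfolding size_le_def by (intro exI[of _ "\<lambda>i. if i = 0 then 1 else 0"] conjI)
qed

lemma size_le_add:
  assumes "size_le y X" "size_le z Y"
  shows "size_le (y + z) (X + Y)"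
proof -
  obtain r where r: "y = (\<Sum>i<d. of_int (r i) * \<alpha> ^ i)" "(\<Sum>i<d. \<bar>r i\<bar>) \<le> int X"
    using assms(1) by (rule size_leE)
  obtain q where q: "z = (\<Sum>i<d. of_int (q i) * \<alpha> ^ i)" "(\<Sum>i<d. \<bar>q i\<bar>) \<le> int Y"
    using assms(2) by (rule size_leE)
  have "(\<Sum>i<d. \<bar>r i + q i\<bar>) \<le> (\<Sum>i<d. \<bar>r i\<bar> + \<bar>q i\<bar>)"
    by (intro sum_mono abs_triangle_ineq)
  also have "\<dots> \<le> int (X + Y)" using r(2) q(2) by (simp add: sum.distrib)
  finally show ?thesis unfolding size_le_def
    by (intro exI[of _ "\<lambda>i. r i + q i"]) (simp add: r(1) q(1) sum.distrib ring_distribs)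
qed

lemma size_le_scale:
  assumes "size_le y X"
  shows "size_le (of_int c * y) (nat \<bar>c\<bar> * X)"
proof -
  obtain r where r: "y = (\<Sum>i<d. of_int (r i) * \<alpha> ^ i)" "(\<Sum>i<d. \<bar>r i\<bar>) \<le> int X"
    using assms(1) by (rule size_leE)
  have "(\<Sum>i<d. \<bar>c * r i\<bar>) = \<bar>c\<bar> * (\<Sum>i<d. \<bar>r i\<bar>)"
    by (simp add: abs_mult sum_distrib_left)
  also have "\<dots> \<le> int (nat \<bar>c\<bar> * X)" using r(2) by (simp add: mult_left_mono)
  finally show ?thesis unfolding size_le_def
    by (intro exI[of _ "\<lambda>i. c * r i"]) (simp add: r(1) sum_distrib_left mult.assoc)
qed

lemma size_le_sum:
  assumes "\<And>i. i \<in> I \<Longrightarrow> size_le (g i) (X i)"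
  shows "size_le (sum g I) (sum X I)"
  using assms
  by (induction I rule: infinite_finite_induct) (auto simp: size_le_0 intro: size_le_add)

lemma size_le_times_generator:
  assumes "size_le y X"
  shows "size_le (\<alpha> * y) (K * X)"
proof -
  obtain r where r: "y = (\<Sum>i<d. of_int (r i) * \<alpha> ^ i)" "(\<Sum>i<d. \<bar>r i\<bar>) \<le> int X"
    using assms(1) by (rule size_leE)
  obtain d' where d': "d = Suc d'" using d_pos gr0_implies_Suc by blast
  define r' where "r' i = (if i = 0 then 0 else r (i - 1)) + r d' * e i" for i
  have shift: "(\<Sum>i<d. of_int (if i = 0 then 0 else r (i - 1)) * \<alpha> ^ i)
      = (\<Sum>i<d'. of_int (r i) * \<alpha> ^ Suc i)"
    unfolding d' by (subst sum.lessThan_Suc_shift) simp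
  have "\<alpha> * y = (\<Sum>i<d'. of_int (r i) * \<alpha> ^ Suc i) + of_int (r d') * \<alpha> ^ d"
    by (simp add: r(1) d' sum_distrib_left algebra_simps)
  also have "\<dots> = (\<Sum>i<d. of_int (r' i) * \<alpha> ^ i)"
    unfolding relation shift[symmetric]
    by (simp add: r'_def sum_distrib_left sum.distrib[symmetric] ring_distribs mult.assoc)
  finally have eq: "\<alpha> * y = (\<Sum>i<d. of_int (r' i) * \<alpha> ^ i)" .
  have "(\<Sum>i<d. \<bar>r' i\<bar>) \<le> (\<Sum>i<d. \<bar>if i = 0 then 0 else r (i - 1)\<bar> + \<bar>r d'\<bar> * \<bar>e i\<bar>)"
    unfolding r'_def abs_mult[symmetric] by (intro sum_mono abs_triangle_ineq)
  also have "\<dots> = (\<Sum>i<d'. \<bar>r i\<bar>) + \<bar>r d'\<bar> * (\<Sum>i<d. \<bar>e i\<bar>)"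
  proof -
    have "(\<Sum>i<d. \<bar>if i = 0 then 0 else r (i - 1)\<bar>) = (\<Sum>i<d'. \<bar>r i\<bar>)"
      unfolding d' by (subst sum.lessThan_Suc_shift) simp
    thus ?thesis by (simp only: sum.distrib sum_distrib_left)
  qed
  also have "\<dots> \<le> (\<Sum>i<d'. \<bar>r i\<bar>) + \<bar>r d'\<bar> * (int K - 1)"
    using K_bound by (intro add_mono mult_left_mono) auto
  also have "(\<Sum>i<d'. \<bar>r i\<bar>) \<le> int K * (\<Sum>i<d'. \<bar>r i\<bar>)"
    using K_pos mult_right_mono[of 1 "int K" "\<Sum>i<d'. \<bar>r i\<bar>"] by (simp add: sum_nonneg)
  also have "int K * (\<Sum>i<d'. \<bar>r i\<bar>) + \<bar>r d'\<bar> * (int K - 1) \<le> int K * (\<Sum>i<d. \<bar>r i\<bar>)"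
    by (simp add: d' algebra_simps)
  also have "\<dots> \<le> int (K * X)" using r(2) by (simp add: mult_left_mono)
  finally have "(\<Sum>i<d. \<bar>r' i\<bar>) \<le> int (K * X)" by simp
  with eq show ?thesis unfolding size_le_def by blast
qed

lemma size_le_generator_power_times: "size_le y X \<Longrightarrow> size_le (\<alpha> ^ j * y) (K ^ j * X)"
proof (induction j)
  case (Suc j)
  thus ?case using size_le_times_generator[of "\<alpha> ^ j * y" "K ^ j * X"] by (simp add: mult.assoc)
qed simp

lemma size_le_generator_power: "size_le (\<alpha> ^ j) (K ^ j)"
  using size_le_generator_power_times[OF size_le_1, of j] by simp

lemma size_le_mult:
  assumes "size_le y X" "size_le z Y"
  shows "size_le (y * z) (K ^ d * X * Y)"
proof -
  obtain r where r: "y = (\<Sum>i<d. of_int (r i) * \<alpha> ^ i)" "(\<Sum>i<d. \<bar>r i\<bar>) \<le> int X"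
    using assms(1) by (rule size_leE)
  have "size_le (\<alpha> ^ i * z) (K ^ d * Y)" if "i < d" for i
    using size_le_generator_power_times[OF assms(2), of i]
    by (rule size_le_mono) (use that K_pos in \<open>auto intro!: mult_right_mono power_increasing\<close>)
  hence "size_le (\<Sum>i<d. of_int (r i) * (\<alpha> ^ i * z)) (\<Sum>i<d. nat \<bar>r i\<bar> * (K ^ d * Y))"
    by (intro size_le_sum size_le_scale) auto
  moreover have "(\<Sum>i<d. of_int (r i) * (\<alpha> ^ i * z)) = y * z"
    by (simp add: r(1) sum_distrib_right mult.assoc)
  moreover have "(\<Sum>i<d. nat \<bar>r i\<bar> * (K ^ d * Y)) \<le> K ^ d * X * Y"
  proof -
    have "int (\<Sum>i<d. nat \<bar>r i\<bar>) \<le> int X" using r(2) by simp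
    hence "(\<Sum>i<d. nat \<bar>r i\<bar>) \<le> X" by (simp only: of_nat_le_iff)
    have "(\<Sum>i<d. nat \<bar>r i\<bar> * (K ^ d * Y)) = (\<Sum>i<d. nat \<bar>r i\<bar>) * (K ^ d * Y)"
      by (rule sum_distrib_right[symmetric])
    also have "\<dots> \<le> X * (K ^ d * Y)" using \<open>(\<Sum>i<d. nat \<bar>r i\<bar>) \<le> X\<close> by (rule mult_right_mono) simp
    finally show ?thesis by (simp only: mult_ac)
  qed
  ultimately show ?thesis using size_le_mono[of "y * z"] by simp
qed

lemma size_le_power:
  assumes "size_le y X"
  shows "size_le (y ^ j) ((K ^ d * X) ^ j)"
proof (induction j)
  case 0
  show ?case using size_le_1 by simp
next
  case (Suc j)
  thus ?case using size_le_mult[OF assms Suc] by simp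
qed

lemma size_le_poly:
  assumes y: "size_le y X" and X: "X \<ge> 1" and p: "degree p \<le> k" "\<And>i. \<bar>coeff p i\<bar> \<le> int H"
  shows "size_le (ipoly p y) (Suc k * (H * (K ^ d * X) ^ k))"
proof -
  have base: "1 \<le> K ^ d * X" using X K_pos by simp
  have "size_le (of_int (coeff p j) * y ^ j) (H * (K ^ d * X) ^ k)" if "j \<le> k" for j
  proof (rule size_le_mono[OF size_le_scale[OF size_le_power[OF y]]])
    have "nat \<bar>coeff p j\<bar> \<le> H" using p(2)[of j] by simp
    thus "nat \<bar>coeff p j\<bar> * (K ^ d * X) ^ j \<le> H * (K ^ d * X) ^ k"
      using base that by (intro mult_mono power_increasing) auto
  qed
  hence "size_le (\<Sum>j\<le>k. of_int (coeff p j) * y ^ j) (\<Sum>j\<le>k. H * (K ^ d * X) ^ k)"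
    by (intro size_le_sum) auto
  thus ?thesis by (simp add: ipoly_altdef[OF p(1)])
qed

text \<open>
  The bound that the pigeonhole argument below produces for an element of size \<open>X\<close>. For fixed \<open>\<alpha>\<close>
  it is a constant times a power of \<open>X\<close>.
\<close>
definition relation_bound :: "nat \<Rightarrow> nat" where
  "relation_bound X = (2 * (d + 1) * (K ^ d * X) ^ d) ^ d"

lemma relation_bound_ge_1:
  assumes "X \<ge> 1"
  shows "relation_bound X \<ge> 1"
proof -
  have "relation_bound X > 0"
    unfolding relation_bound_def using assms K_pos by (intro zero_less_power mult_pos_pos) auto
  thus ?thesis by simp
qed

text \<open>
  Consider all sums \<open>c\<^sub>0 + c\<^sub>1 y + \<dots> + c\<^sub>d y\<^sup>d\<close> with \<open>0 \<le> c\<^sub>j \<le> N\<close>. There are \<open>(N + 1)\<^bsup>d+1\<^esup>\<close> of them,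
  but their coefficient vectors with respect to \<open>1, \<alpha>, \<dots>, \<alpha>\<^bsup>d-1\<^esup>\<close> lie in a box with at most
  \<open>(T (N + 1))\<^sup>d\<close> points, where \<open>T\<close> does not depend on \<open>N\<close>. For \<open>N = T\<^sup>d\<close> two of the sums coincide, and
  their difference is the relation.
\<close>
lemma small_relation:
  assumes y: "size_le y X" and X: "X \<ge> 1"
  obtains p where "p \<noteq> 0" "degree p \<le> d" "\<And>i. \<bar>coeff p i\<bar> \<le> int (relation_bound X)" "ipoly p y = 0"
proof -
  define W where "W = (K ^ d * X) ^ d"
  \<comment> \<open>each side of the box of coefficient vectors has \<open>2 (d + 1) N W + 1 \<le> T (N + 1)\<close> points\<close>
  define T where "T = 2 * (d + 1) * W"
  define N where "N = T ^ d"
  have N: "N = relation_bound X" by (simp add: N_def T_def W_def relation_bound_def)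
  have base: "1 \<le> K ^ d * X" using X K_pos by simp
  hence W1: "W \<ge> 1" by (simp add: W_def)
  have "\<forall>j. \<exists>r. j \<le> d \<longrightarrow> y ^ j = (\<Sum>i<d. of_int (r i) * \<alpha> ^ i) \<and> (\<Sum>i<d. \<bar>r i\<bar>) \<le> int W"
  proof -
    have "size_le (y ^ j) W" if "j \<le> d" for j
      unfolding W_def by (rule size_le_mono[OF size_le_power[OF y] power_increasing[OF that base]])
    thus ?thesis unfolding size_le_def by blast
  qed
  from choice[OF this] have "\<exists>r. \<forall>j. j \<le> d \<longrightarrow> y ^ j = (\<Sum>i<d. of_int (r j i) * \<alpha> ^ i) \<and>
      (\<Sum>i<d. \<bar>r j i\<bar>) \<le> int W" .
  then obtain r where r: "\<And>j. j \<le> d \<Longrightarrow> y ^ j = (\<Sum>i<d. of_int (r j i) * \<alpha> ^ i)"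
    "\<And>j. j \<le> d \<Longrightarrow> (\<Sum>i<d. \<bar>r j i\<bar>) \<le> int W"
    by blast
  define V where "V = int ((d + 1) * N * W)"
  define A where "A = PiE {..d} (\<lambda>_. {0..int N})"
  define B where "B = PiE {..<d} (\<lambda>_. {-V..V})"
  define \<Phi> where "\<Phi> c = restrict (\<lambda>i. \<Sum>j\<le>d. c j * r j i) {..<d}" for c :: "nat \<Rightarrow> int"
  have "\<Phi> c \<in> B" if c: "c \<in> A" for c
    unfolding B_def \<Phi>_def
  proof (rule PiE_I)
    fix i assume i: "i \<in> {..<d}"
    have "\<bar>\<Sum>j\<le>d. c j * r j i\<bar> \<le> (\<Sum>j\<le>d. \<bar>c j * r j i\<bar>)" by (rule sum_abs)
    also have "\<dots> \<le> (\<Sum>j\<le>d. int N * int W)"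
    proof (rule sum_mono)
      fix j assume j: "j \<in> {..d}"
      have "c j \<in> {0..int N}" using c j by (auto simp: A_def)
      moreover have "\<bar>r j i\<bar> \<le> (\<Sum>i<d. \<bar>r j i\<bar>)" by (rule member_le_sum) (use i in auto)
      hence "\<bar>r j i\<bar> \<le> int W" using r(2)[of j] j by simp
      ultimately show "\<bar>c j * r j i\<bar> \<le> int N * int W"
        unfolding abs_mult by (intro mult_mono) auto
    qed
    also have "\<dots> = V" by (simp add: V_def algebra_simps)
    finally have "(\<Sum>j\<le>d. c j * r j i) \<in> {-V..V}" by auto
    thus "restrict (\<lambda>i. \<Sum>j\<le>d. c j * r j i) {..<d} i \<in> {-V..V}" using i by simp
  next
    fix i assume "i \<notin> {..<d}"
    thus "restrict (\<lambda>i. \<Sum>j\<le>d. c j * r j i) {..<d} i = undefined" by simp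
  qed
  hence sub: "\<Phi> ` A \<subseteq> B" by blast
  have "finite B" by (simp add: B_def finite_PiE)
  have cardA: "card A = (N + 1) ^ (d + 1)" by (simp add: A_def card_PiE nat_add_distrib)
  have "card B = (2 * ((d + 1) * N * W) + 1) ^ d"
  proof -
    have V: "V = int ((d + 1) * N * W)" by (fact V_def)
    have "nat (1 + V - - V) = 2 * ((d + 1) * N * W) + 1" unfolding V by linarith
    hence "card {-V..V} = 2 * ((d + 1) * N * W) + 1" by simp
    thus ?thesis by (simp add: B_def card_PiE del: card_atLeastAtMost_int)
  qed
  also have "\<dots> \<le> (T * (N + 1)) ^ d"
  proof (rule power_mono)
    have "1 \<le> T" using W1 unfolding T_def by (cases W) auto
    moreover have "2 * ((d + 1) * N * W) = T * N" by (simp only: T_def mult_ac)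
    ultimately show "2 * ((d + 1) * N * W) + 1 \<le> T * (N + 1)" by simp
  qed simp
  also have "\<dots> = N * (N + 1) ^ d" by (simp only: power_mult_distrib N_def)
  also have "\<dots> < card A" by (simp add: cardA)
  finally have "card (\<Phi> ` A) < card A"
    using card_mono[OF \<open>finite B\<close> sub] by simp
  hence "\<not> inj_on \<Phi> A" by (rule pigeonhole)
  then obtain c c' where c: "c \<in> A" "c' \<in> A" "c \<noteq> c'" "\<Phi> c = \<Phi> c'"
    by (auto simp: inj_on_def)
  obtain p where p: "\<And>i. coeff p i = (if i \<le> d then c i - c' i else 0)" "degree p \<le> d"
    "\<And>x. ipoly p x = (\<Sum>i\<le>d. of_int (c i - c' i) * x ^ i)"
    using ipoly_of_coeffs[of d "\<lambda>i. c i - c' i"] by blast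
  have vanish: "(\<Sum>j\<le>d. (c j - c' j) * r j i) = 0" if "i < d" for i
    using fun_cong[OF c(4), of i] that by (simp add: \<Phi>_def algebra_simps sum_subtractf)
  have "ipoly p y = (\<Sum>j\<le>d. \<Sum>i<d. of_int ((c j - c' j) * r j i) * \<alpha> ^ i)"
    unfolding p(3) by (intro sum.cong refl) (simp add: r(1) sum_distrib_left mult.assoc)
  also have "\<dots> = (\<Sum>i<d. of_int (\<Sum>j\<le>d. (c j - c' j) * r j i) * \<alpha> ^ i)"
    by (subst sum.swap) (simp add: sum_distrib_right)
  also have "\<dots> = 0" by (rule sum.neutral) (use vanish in auto)
  finally have "ipoly p y = 0" .
  moreover have "p \<noteq> 0"
  proof
    assume "p = 0"
    hence "c i = c' i" if "i \<le> d" for i using p(1)[of i] that by simp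
    hence "c = c'" using c(1,2) unfolding A_def by (intro PiE_ext) auto
    thus False using c(3) by simp
  qed
  moreover have "\<bar>coeff p i\<bar> \<le> int (relation_bound X)" for i
  proof (cases "i \<le> d")
    case True
    hence "c i \<in> {0..int N}" "c' i \<in> {0..int N}" using c(1,2) by (auto simp: A_def)
    thus ?thesis using True by (auto simp: p(1) N abs_le_iff)
  qed (simp add: p(1))
  ultimately show ?thesis using that p(2) by blast
qed

text \<open>
  For \<open>\<bar>y\<bar> \<le> 1\<close>, divide the small relation by its lowest power of \<open>y\<close>: a non-zero integer equals
  \<open>y\<close> times a sum of at most \<open>d\<close> terms, none of which exceeds the largest coefficient.
\<close>
lemma liouville_lower_bound:
  assumes y: "size_le y X" and X: "X \<ge> 1" and nz: "y \<noteq> 0"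
  shows "1 \<le> real (d * relation_bound X) * cmod y"
proof (cases "cmod y \<le> 1")
  case False
  have "0 < d * relation_bound X" using relation_bound_ge_1[OF X] d_pos by simp
  hence "1 \<le> real (d * relation_bound X)" by linarith
  thus ?thesis using False mult_mono[of 1 "real (d * relation_bound X)" 1 "cmod y"] by simp
next
  case True
  define N where "N = relation_bound X"
  obtain p where p: "p \<noteq> 0" "degree p \<le> d" "\<And>i. \<bar>coeff p i\<bar> \<le> int N" "ipoly p y = 0"
    using small_relation[OF y X] unfolding N_def by blast
  have coeff_le: "cmod (of_int (coeff p i)) \<le> real N" for i
    using p(3)[of i] by (simp flip: of_int_abs)
  define j where "j = (LEAST i. coeff p i \<noteq> 0)"
  have "\<exists>i. coeff p i \<noteq> 0" using p(1) by (auto simp: poly_eq_iff)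
  hence cj: "coeff p j \<noteq> 0" unfolding j_def by (rule LeastI_ex)
  have below: "coeff p i = 0" if "i < j" for i
    using not_less_Least that unfolding j_def by blast
  have "j \<le> d" using cj p(2) le_degree order.trans by blast
  have "0 = (\<Sum>i\<le>d. of_int (coeff p i) * y ^ i)"
    using p(4) ipoly_altdef[OF p(2)] by simp
  also have "\<dots> = (\<Sum>i\<in>{j..d}. of_int (coeff p i) * y ^ i)"
    by (rule sum.mono_neutral_right) (auto simp: below)
  also have "\<dots> = of_int (coeff p j) * y ^ j + (\<Sum>i\<in>{Suc j..d}. of_int (coeff p i) * y ^ i)"
    using \<open>j \<le> d\<close> by (simp add: sum.atLeast_Suc_atMost)
  also have "(\<Sum>i\<in>{Suc j..d}. of_int (coeff p i) * y ^ i)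
      = y ^ j * (y * (\<Sum>i\<in>{Suc j..d}. of_int (coeff p i) * y ^ (i - Suc j)))"
    unfolding sum_distrib_left
  proof (rule sum.cong[OF refl])
    fix i assume "i \<in> {Suc j..d}"
    hence "y ^ i = y ^ j * (y * y ^ (i - Suc j))"
      by (metis atLeastAtMost_iff le_add_diff_inverse mult.assoc power_Suc2 power_add)
    thus "of_int (coeff p i) * y ^ i = y ^ j * (y * (of_int (coeff p i) * y ^ (i - Suc j)))"
      by simp
  qed
  finally have "y ^ j * (of_int (coeff p j) + y * (\<Sum>i\<in>{Suc j..d}. of_int (coeff p i) * y ^ (i - Suc j))) = 0"
    by (simp add: algebra_simps)
  hence eq: "of_int (coeff p j) = - (y * (\<Sum>i\<in>{Suc j..d}. of_int (coeff p i) * y ^ (i - Suc j)))"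
    using nz by (simp add: add_eq_0_iff2)
  have "1 \<le> cmod (of_int (coeff p j))"
    using cj by (simp flip: of_int_abs)
  also have "\<dots> = cmod y * cmod (\<Sum>i\<in>{Suc j..d}. of_int (coeff p i) * y ^ (i - Suc j))"
    by (simp add: eq norm_mult)
  also have "\<dots> \<le> cmod y * (\<Sum>i\<in>{Suc j..d}. real N)"
  proof (intro mult_left_mono sum_norm_le)
    fix i
    have "cmod (of_int (coeff p i) * y ^ (i - Suc j)) \<le> real N * 1"
      unfolding norm_mult norm_power
      by (intro mult_mono coeff_le power_le_one) (use True in auto)
    thus "cmod (of_int (coeff p i) * y ^ (i - Suc j)) \<le> real N" by simp
  qed simp
  also have "\<dots> \<le> cmod y * (real d * real N)"
    by (intro mult_left_mono) (auto intro!: mult_right_mono)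
  finally show ?thesis by (simp add: N_def mult_ac)
qed

lemma poly_height_bound:
  assumes y: "size_le y X" and X: "X \<ge> 1" and M: "is_min_int_poly M y"
  shows "poly_height M \<le> int (relation_bound X * (relation_bound X + 2) ^ d)"
proof -
  define N where "N = relation_bound X"
  obtain p where p: "p \<noteq> 0" "degree p \<le> d" "\<And>i. \<bar>coeff p i\<bar> \<le> int N" "ipoly p y = 0"
    using small_relation[OF y X] unfolding N_def by blast
  have dvd: "M dvd p" using is_min_int_poly_dvd_annihilator[OF M p(4)] .
  have "\<bar>coeff M i\<bar> \<le> int (N * (N + 2) ^ d)" for i
  proof -
    have "degree M \<le> d" using dvd_imp_degree_le[OF dvd p(1)] p(2) by simp
    hence "int (N * (N + 2) ^ degree M) \<le> int (N * (N + 2) ^ d)"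
      by (intro of_nat_mono mult_left_mono power_increasing) auto
    thus ?thesis using coeff_bound_divisor[OF dvd p(1) p(3), of i] by simp
  qed
  thus ?thesis unfolding N_def[symmetric] by (rule poly_height_le)
qed

lemma size_le_imp_algebraic:
  assumes "size_le y X"
  shows "algebraic y"
proof -
  have "size_le y (max 1 X)" by (rule size_le_mono[OF assms]) simp
  thus ?thesis
  proof (rule small_relation[OF _ max.cobounded1])
    fix p assume "p \<noteq> 0" "ipoly p y = 0"
    thus "algebraic y"
      by (intro algebraicI[of "map_poly of_int p"]) (auto simp: coeff_map_poly map_poly_eq_0_iff)
  qed
qed

end

section \<open>Approximation along gaps\<close>

lemma eventually_ratio_ge:
  fixes s t :: "nat \<Rightarrow> nat"
  assumes "filterlim (\<lambda>n. real (t n) / real (s n)) at_top sequentially"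
  shows "\<forall>\<^sub>F n in sequentially. c * real (s n) \<le> real (t n)"
proof -
  have "\<forall>\<^sub>F n in sequentially. c \<le> real (t n) / real (s n)"
    using assms by (simp add: filterlim_at_top)
  thus ?thesis
  proof eventually_elim
    case (elim n)
    show ?case
      by (cases "s n = 0") (use elim in \<open>auto simp: pos_le_divide_eq\<close>)
  qed
qed

lemma interlaced_ge_index:
  fixes s t :: "nat \<Rightarrow> nat"
  assumes "\<And>n. n \<ge> 1 \<Longrightarrow> t (n - 1) \<le> s n \<and> s n < t n"
  shows "n \<le> t n" "n \<le> s (Suc n)"
proof -
  show "n \<le> t n"
  proof (induction n)
    case (Suc n)
    thus ?case using assms[of "Suc n"] by simp
  qed simp
  thus "n \<le> s (Suc n)" using assms[of "Suc n"] by simp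
qed

text \<open>
  Here \<open>h\<close> stands for the logarithmic height of \<open>x\<close>. For the least sufficiently large \<open>n\<close>
  with \<open>t\<^sub>n \<ge> Q h\<close>, where \<open>Q h\<close> is a suitable affine function of \<open>h\<close>, the distance from \<open>\<gamma>\<close> to \<open>\<beta>\<^sub>n\<close> is at most half of that from \<open>x\<close> to
  \<open>\<beta>\<^sub>n\<close>. By minimality \<open>t\<^bsub>n-1\<^esub> < Q h\<close>, hence \<open>s\<^sub>n\<close> is bounded by a multiple of \<open>Q h\<close>, and the
  lower bound for the distance from \<open>x\<close> to \<open>\<beta>\<^sub>n\<close> becomes one in terms of \<open>h\<close> alone.
\<close>
lemma gap_approximation_bound:
  fixes \<gamma> :: complex and \<beta> :: "nat \<Rightarrow> complex" and s t :: "nat \<Rightarrow> nat"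
  assumes chain: "\<And>n. n \<ge> 1 \<Longrightarrow> t (n - 1) \<le> s n \<and> s n < t n"
    and lim: "filterlim (\<lambda>n. real (t n) / real (s n)) at_top sequentially"
    and B: "\<And>n. n \<ge> 1 \<Longrightarrow> real (s (n + 1)) / real (t n) \<le> B"
    and conv: "\<And>n. n \<ge> 1 \<Longrightarrow> dist \<gamma> (\<beta> n) \<le> exp (G - l * real (t n))"
    and pos: "l > 0" "D \<ge> 0" "E \<ge> 0" "F \<ge> 0"
  obtains w W where "w \<ge> 0"
    "\<And>x h. h \<ge> 0 \<Longrightarrow>
       (\<And>n. n \<ge> n0 \<Longrightarrow> dist x (\<beta> n) \<ge> exp (- (D * h + E * real (s n) + F))) \<Longrightarrow>
       dist \<gamma> x \<ge> exp (- (w * h + W))"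
proof -
  obtain n1 where n1: "\<And>n. n \<ge> n1 \<Longrightarrow> (2 * E / l) * real (s n) \<le> real (t n)"
    using eventually_ratio_ge[OF lim, of "2 * E / l"] by (auto simp: eventually_sequentially)
  define n2 where "n2 = max 1 (max n0 n1)"
  define B' where "B' = max B 0"
  define Q where "Q h = (2 / l) * (D * h + F + \<bar>G\<bar> + ln 2)" for h
  \<comment> \<open>obtained by inserting \<open>s\<^sub>n \<le> s\<^bsub>n2\<^esub> + B' Q h\<close> into \<open>D h + E s\<^sub>n + F + ln 2\<close>\<close>
  define w where "w = D + E * B' * (2 / l) * D"
  define W where "W = E * real (s n2) + E * B' * (2 / l) * (F + \<bar>G\<bar> + ln 2) + F + ln 2"
  have ln2: "ln 2 > (0::real)" by simp
  have B'0: "B' \<ge> 0" by (simp add: B'_def)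
  show ?thesis
  proof (rule that)
    show "w \<ge> 0" using pos B'0 by (simp add: w_def)
    fix x :: complex and h :: real
    assume h: "h \<ge> 0" and far: "\<And>n. n \<ge> n0 \<Longrightarrow> dist x (\<beta> n) \<ge> exp (- (D * h + E * real (s n) + F))"
    have Q0: "Q h \<ge> 0" using pos h ln2 by (simp add: Q_def)
    define P where "P n \<longleftrightarrow> n \<ge> n2 \<and> Q h \<le> real (t n)" for n
    have "P (max n2 (nat \<lceil>Q h\<rceil>))"
    proof -
      have "Q h \<le> real (nat \<lceil>Q h\<rceil>)" by linarith
      also have "\<dots> \<le> real (t (max n2 (nat \<lceil>Q h\<rceil>)))"
        using interlaced_ge_index(1)[of t s "max n2 (nat \<lceil>Q h\<rceil>)", OF chain] by simp
      finally show ?thesis by (simp add: P_def)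
    qed
    hence ex: "\<exists>n. P n" ..
    define n where "n = (LEAST n. P n)"
    have "P n" unfolding n_def using ex by (rule LeastI_ex)
    hence n: "n \<ge> n2" "Q h \<le> real (t n)" by (auto simp: P_def)
    have n': "n \<ge> 1" "n \<ge> n0" "n \<ge> n1" using n(1) by (auto simp: n2_def)
    define a where "a = D * h + E * real (s n) + F"
    have "E * real (s n) \<le> l / 2 * real (t n)"
      using n1[OF n'(3)] pos by (simp add: field_simps)
    moreover have "D * h + F + \<bar>G\<bar> + ln 2 \<le> l / 2 * real (t n)"
      using n(2) pos by (simp add: Q_def field_simps)
    ultimately have "G - l * real (t n) \<le> - a - ln 2"
      unfolding a_def by (simp add: field_simps)
    hence "exp (G - l * real (t n)) \<le> exp (- a - ln 2)" by simp
    also have "\<dots> = exp (- a) / 2" by (simp add: exp_diff)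
    finally have near: "dist \<gamma> (\<beta> n) \<le> exp (- a) / 2" using conv[OF n'(1)] by linarith
    have "exp (- a) \<le> dist x (\<beta> n)" using far[OF n'(2)] by (simp add: a_def)
    also have "\<dots> \<le> dist \<gamma> x + dist \<gamma> (\<beta> n)"
      by (rule dist_triangle3)
    finally have "dist \<gamma> x \<ge> exp (- a) / 2" using near by linarith
    hence dist: "dist \<gamma> x \<ge> exp (- (a + ln 2))" by (simp add: exp_diff)
    \<comment> \<open>the summand \<open>s n2\<close> covers the case that the search for \<open>n\<close> stops at its starting index\<close>
    have "real (s n) \<le> real (s n2) + B' * Q h"
    proof (cases "n = n2")
      case True
      thus ?thesis using B'0 Q0 by simp
    next
      case False
      define k where "k = n - 1"
      have k: "n = k + 1" "k \<ge> n2" "k \<ge> 1" using False n(1) n' by (auto simp: k_def n2_def)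
      have "\<not> P k" using not_less_Least[of k P] k(1) by (simp add: n_def[symmetric])
      hence tk: "real (t k) < Q h" using k(2) by (simp add: P_def)
      have "t k > 0" using chain[OF k(3)] by linarith
      hence "real (s n) \<le> B * real (t k)"
        using B[OF k(3)] by (simp add: k(1) pos_divide_le_eq)
      also have "\<dots> \<le> B' * Q h"
        using tk B'0 by (intro mult_mono) (auto simp: B'_def)
      finally show ?thesis by simp
    qed
    hence "E * real (s n) \<le> E * (real (s n2) + B' * Q h)" using pos(3) by (rule mult_left_mono)
    hence "a + ln 2 \<le> w * h + W"
      by (simp add: a_def w_def W_def Q_def algebra_simps add_divide_distrib)
    hence "exp (- (w * h + W)) \<le> exp (- (a + ln 2))" by simp
    thus "exp (- (w * h + W)) \<le> dist \<gamma> x" using dist by linarith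
  qed
qed

lemma eventually_eq_limit_if_finite_values:
  fixes x :: "nat \<Rightarrow> complex"
  assumes "x \<longlonglongrightarrow> l" "finite S" "\<forall>\<^sub>F n in sequentially. x n \<in> S"
  shows "\<forall>\<^sub>F n in sequentially. x n = l"
proof -
  have op: "open (- (S - {l}))" 
    by (intro open_Compl finite_imp_closed) (use assms(2) in simp)
  have "\<forall>\<^sub>F n in sequentially. x n \<in> - (S - {l})"
    by (rule topological_tendstoD[OF assms(1) op]) simp
  with assms(3) show ?thesis by eventually_elim auto
qed

lemma norm_power_diff_bound:
  fixes x y :: complex
  assumes "cmod x \<le> R" "cmod y \<le> R" "R \<ge> 1"
  shows "cmod (x ^ j - y ^ j) \<le> real j * R ^ j * cmod (x - y)"
proof (induction j)
  case (Suc j)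
  have "x ^ Suc j - y ^ Suc j = x * (x ^ j - y ^ j) + (x - y) * y ^ j"
    by (simp add: algebra_simps)
  also have "cmod \<dots> \<le> R * (real j * R ^ j * cmod (x - y)) + cmod (x - y) * R ^ j"
  proof (rule order.trans[OF norm_triangle_ineq], rule add_mono)
    show "cmod (x * (x ^ j - y ^ j)) \<le> R * (real j * R ^ j * cmod (x - y))"
      unfolding norm_mult by (rule mult_mono) (use assms Suc in auto)
    show "cmod ((x - y) * y ^ j) \<le> cmod (x - y) * R ^ j"
      unfolding norm_mult norm_power by (intro mult_left_mono power_mono) (use assms in auto)
  qed
  also have "R ^ j \<le> R ^ Suc j" using assms by (intro power_increasing) auto
  hence "R * (real j * R ^ j * cmod (x - y)) + cmod (x - y) * R ^ j
      \<le> R * (real j * R ^ j * cmod (x - y)) + cmod (x - y) * R ^ Suc j"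
    by (intro add_mono mult_left_mono) (use assms in auto)
  also have "\<dots> = real (Suc j) * R ^ Suc j * cmod (x - y)" by (simp add: algebra_simps)
  finally show ?case .
qed simp

lemma ipoly_diff_bound:
  assumes p: "degree p \<le> k" "\<And>i. \<bar>coeff p i\<bar> \<le> int H"
    and R: "cmod x \<le> R" "cmod y \<le> R" "R \<ge> 1"
  shows "cmod (ipoly p x - ipoly p y) \<le> real H * (real (Suc k) ^ 2 * R ^ k) * cmod (x - y)"
proof -
  have "ipoly p x - ipoly p y = (\<Sum>j\<le>k. of_int (coeff p j) * (x ^ j - y ^ j))"
    by (simp add: ipoly_altdef[OF p(1)] sum_subtractf ring_distribs)
  also have "cmod \<dots> \<le> (\<Sum>j\<le>k. real H * (real (Suc k) * R ^ k * cmod (x - y)))"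
  proof (rule sum_norm_le)
    fix j assume "j \<in> {..k}"
    hence j: "j \<le> k" by simp
    have "cmod (x ^ j - y ^ j) \<le> real j * R ^ j * cmod (x - y)"
      by (rule norm_power_diff_bound[OF R])
    also have "\<dots> \<le> real (Suc k) * R ^ k * cmod (x - y)"
      using j R by (intro mult_right_mono mult_mono power_increasing) auto
    finally have 1: "cmod (x ^ j - y ^ j) \<le> real (Suc k) * R ^ k * cmod (x - y)" .
    have 2: "cmod (of_int (coeff p j)) \<le> real H"
      using p(2)[of j] by (simp flip: of_int_abs)
    show "cmod (of_int (coeff p j) * (x ^ j - y ^ j)) \<le> real H * (real (Suc k) * R ^ k * cmod (x - y))"
      unfolding norm_mult by (rule mult_mono[OF 2 1]) auto
  qed
  also have "\<dots> = real H * (real (Suc k) ^ 2 * R ^ k) * cmod (x - y)"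
    by (simp add: power2_eq_square)
  finally show ?thesis .
qed

text \<open>
  Below the degree of the minimal polynomial the powers of \<open>x\<close> are linearly independent over \<open>\<rat>\<close>,
  so a rational value must equal the constant coefficient \<open>r 0\<close>.
\<close>
lemma rational_combination_is_int:
  assumes M: "is_min_int_poly M x" "d \<le> degree M" and d: "d > 0"
    and y: "(\<Sum>i<d. of_int (r i) * x ^ i) \<in> \<rat>"
  shows "(\<Sum>i<d. of_int (r i) * x ^ i) \<in> \<int>"
proof -
  obtain u v where uv: "v > 0" "(\<Sum>i<d. of_int (r i) * x ^ i) = of_int u / of_int v"
    using y by (auto elim: Rats_cases')
  obtain d' where d': "d = Suc d'" using d gr0_implies_Suc by blast
  define c where "c i = v * r i - (if i = 0 then u else 0)" for i
  obtain p where p: "\<And>i. coeff p i = (if i \<le> d' then c i else 0)" "degree p \<le> d'"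
    "\<And>x. ipoly p x = (\<Sum>i\<le>d'. of_int (c i) * x ^ i)"
    using ipoly_of_coeffs[of d' c] by blast
  have "ipoly p x = (\<Sum>i<d. of_int v * (of_int (r i) * x ^ i) - (if i = 0 then of_int u else 0))"
    unfolding p(3) d' lessThan_Suc_atMost by (intro sum.cong) (auto simp: c_def algebra_simps)
  also have "\<dots> = of_int v * (\<Sum>i<d. of_int (r i) * x ^ i) - of_int u"
    using d by (simp add: sum_subtractf sum_distrib_left sum.delta)
  also have "\<dots> = 0" using uv by simp
  finally have "ipoly p x = 0" .
  hence "p = 0"
    using is_min_int_poly_degree_le[OF M(1), of p] p(2) M(2) d' by fastforce
  hence "v * r 0 = u" using p(1)[of 0] by (simp add: c_def)
  hence "of_int u = (of_int v * of_int (r 0) :: complex)" by auto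
  hence "(\<Sum>i<d. of_int (r i) * x ^ i) = of_int (r 0)" using uv by simp
  thus ?thesis by simp
qed

section \<open>Values of a gap series at an algebraic integer\<close>

locale lacunary_value = integral_relation +
  fixes a :: "nat \<Rightarrow> int" and A :: nat and s t :: "nat \<Rightarrow> nat" and B :: real
  assumes inside: "cmod \<alpha> < 1"
    and coeffs_bounded: "\<And>k. \<bar>a k\<bar> \<le> int A"
    and A_pos: "A \<ge> 1"
    and chain: "\<And>n. n \<ge> 1 \<Longrightarrow> t (n - 1) \<le> s n \<and> s n < t n"
    and gap: "\<And>n k. n \<ge> 1 \<Longrightarrow> s n < k \<Longrightarrow> k < t n \<Longrightarrow> a k = 0"
    and ratio_at_top: "filterlim (\<lambda>n. real (t n) / real (s n)) at_top sequentially"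
    and ratio_bounded: "\<And>n. n \<ge> 1 \<Longrightarrow> real (s (n + 1)) / real (t n) \<le> B"
begin

definition \<gamma> :: complex where "\<gamma> = (\<Sum>k. of_int (a k) * \<alpha> ^ k)"

definition \<beta> :: "nat \<Rightarrow> complex" where "\<beta> n = (\<Sum>k\<le>s n. of_int (a k) * \<alpha> ^ k)"

lemma cmod_coeff_le: "cmod (of_int (a k)) \<le> real A"
  using coeffs_bounded[of k] by (simp flip: of_int_abs)

lemma term_bound: "cmod (of_int (a k) * \<alpha> ^ k) \<le> real A * cmod \<alpha> ^ k"
  unfolding norm_mult norm_power by (intro mult_right_mono cmod_coeff_le) simp

lemma summable_geometric_bound: "summable (\<lambda>k. real A * cmod \<alpha> ^ k)"
  using inside by (intro summable_mult summable_geometric) simp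

lemma summable_terms: "summable (\<lambda>k. of_int (a k) * \<alpha> ^ k)"
  by (rule summable_comparison_test'[OF summable_geometric_bound]) (rule term_bound)

lemma dist_partial_sum:
  assumes "n \<ge> 1"
  shows "dist \<gamma> (\<beta> n) \<le> real A / (1 - cmod \<alpha>) * cmod \<alpha> ^ t n"
proof -
  have "\<beta> n = (\<Sum>k<t n. of_int (a k) * \<alpha> ^ k)"
    unfolding \<beta>_def
    by (rule sum.mono_neutral_left) (use chain[OF assms] gap[OF assms] in auto)
  hence "\<gamma> - \<beta> n = (\<Sum>k. of_int (a (k + t n)) * \<alpha> ^ (k + t n))"
    unfolding \<gamma>_def using suminf_split_initial_segment[OF summable_terms, of "t n"] by simp
  also have "cmod \<dots> \<le> (\<Sum>k. real A * cmod \<alpha> ^ (k + t n))"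
  proof (rule norm_suminf_le)
    show "cmod (of_int (a (k + t n)) * \<alpha> ^ (k + t n)) \<le> real A * cmod \<alpha> ^ (k + t n)" for k
      by (rule term_bound)
    show "summable (\<lambda>k. real A * cmod \<alpha> ^ (k + t n))"
      using summable_ignore_initial_segment[OF summable_geometric_bound] .
  qed
  also have "(\<lambda>k. real A * cmod \<alpha> ^ (k + t n)) sums (real A * cmod \<alpha> ^ t n * (1 / (1 - cmod \<alpha>)))"
    using sums_mult[OF geometric_sums[of "cmod \<alpha>"], of "real A * cmod \<alpha> ^ t n"] inside
    by (simp add: power_add mult_ac)
  hence "(\<Sum>k. real A * cmod \<alpha> ^ (k + t n)) = real A * cmod \<alpha> ^ t n * (1 / (1 - cmod \<alpha>))"
    by (rule sums_unique[symmetric])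
  finally show ?thesis by (simp add: dist_norm)
qed

lemma cmod_partial_sum: "cmod (\<beta> n) \<le> real A / (1 - cmod \<alpha>)"
proof -
  have "cmod (\<beta> n) \<le> (\<Sum>k\<le>s n. real A * cmod \<alpha> ^ k)"
    unfolding \<beta>_def by (rule sum_norm_le) (rule term_bound)
  also have "\<dots> \<le> (\<Sum>k. real A * cmod \<alpha> ^ k)"
    by (rule sum_le_suminf[OF summable_geometric_bound]) auto
  also have "\<dots> = real A / (1 - cmod \<alpha>)"
    using inside by (simp add: suminf_mult suminf_geometric summable_geometric)
  finally show ?thesis .
qed

lemma filterlim_t: "filterlim (\<lambda>n. real (t n)) at_top sequentially"
proof (rule filterlim_at_top_mono[OF filterlim_real_sequentially])
  show "\<forall>\<^sub>F n in sequentially. real n \<le> real (t n)"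
    using interlaced_ge_index(1)[of t s, OF chain] by (intro always_eventually) auto
qed

lemma partial_sums_tendsto: "\<beta> \<longlonglongrightarrow> \<gamma>"
proof -
  have "(\<lambda>n. \<gamma> - \<beta> n) \<longlonglongrightarrow> 0"
  proof (rule Lim_null_comparison)
    show "\<forall>\<^sub>F n in sequentially. norm (\<gamma> - \<beta> n) \<le> real A / (1 - cmod \<alpha>) * cmod \<alpha> ^ n"
      using eventually_ge_at_top[of 1]
    proof eventually_elim
      case (elim n)
      have "cmod \<alpha> ^ t n \<le> cmod \<alpha> ^ n"
        using inside interlaced_ge_index(1)[of t s n, OF chain] by (intro power_decreasing) auto
      hence "real A / (1 - cmod \<alpha>) * cmod \<alpha> ^ t n \<le> real A / (1 - cmod \<alpha>) * cmod \<alpha> ^ n"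
        using inside by (intro mult_left_mono) auto
      thus ?case using dist_partial_sum[OF elim] by (simp add: dist_norm)
    qed
    have "(\<lambda>n. cmod \<alpha> ^ n) \<longlonglongrightarrow> 0" using inside by (intro LIMSEQ_realpow_zero) auto
    thus "(\<lambda>n. real A / (1 - cmod \<alpha>) * cmod \<alpha> ^ n) \<longlonglongrightarrow> 0"
      by (rule tendsto_mult_right_zero)
  qed
  from tendsto_diff[OF tendsto_const[of \<gamma>] this] show ?thesis by simp
qed

lemma size_partial_sum: "size_le (\<beta> n) (A * (2 * K) ^ s n)"
proof -
  have "size_le (\<beta> n) (\<Sum>k\<le>s n. nat \<bar>a k\<bar> * K ^ k)"
    unfolding \<beta>_def by (intro size_le_sum size_le_scale size_le_generator_power)
  moreover have "(\<Sum>k\<le>s n. nat \<bar>a k\<bar> * K ^ k) \<le> (\<Sum>k\<le>s n. A * K ^ s n)"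
  proof (rule sum_mono)
    fix k assume "k \<in> {..s n}"
    moreover have "nat \<bar>a k\<bar> \<le> A" using coeffs_bounded[of k] by simp
    ultimately show "nat \<bar>a k\<bar> * K ^ k \<le> A * K ^ s n"
      using K_pos by (intro mult_mono power_increasing) auto
  qed
  moreover have "(\<Sum>k\<le>s n. A * K ^ s n) \<le> A * (2 * K) ^ s n"
  proof -
    have "Suc (s n) \<le> 2 ^ s n" using less_exp by (rule Suc_leI)
    hence "Suc (s n) * (A * K ^ s n) \<le> 2 ^ s n * (A * K ^ s n)" by (rule mult_right_mono) simp
    thus ?thesis by (simp add: power_mult_distrib mult_ac)
  qed
  ultimately show ?thesis using size_le_mono order.trans by blast
qed

lemma size_bound_ge_1: "A * (2 * K) ^ s n \<ge> 1"
  using A_pos K_pos by simp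

lemma ln_size_bound: "ln (real (A * (2 * K) ^ s n)) = ln A + real (s n) * ln (2 * K)"
  using A_pos K_pos by (simp add: ln_mult ln_realpow ring_distribs)

lemma relation_bound_eq: "relation_bound X = relation_bound 1 * X ^ (d * d)"
  unfolding relation_bound_def
  by (simp only: power_mult_distrib power_mult mult_1_right power_one mult.assoc)

text \<open>
  The number \<open>p(\<beta>\<^sub>n)\<close> is a non-zero element of \<open>\<int>[\<alpha>]\<close> whose size is polynomial in \<open>H\<close> and
  exponential in \<open>s\<^sub>n\<close>, so it is bounded away from \<open>0\<close>. As \<open>p(x) = 0\<close>, it is also at most a multiple
  of the distance from \<open>x\<close> to \<open>\<beta>\<^sub>n\<close>. For a fixed series and \<open>\<alpha>\<close> the constants depend only on the degree
  bound \<open>k\<close> and on the radius \<open>R\<close> of a disc containing \<open>x\<close>.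
\<close>
lemma annihilator_lower_bound:
  obtains D E F :: real where "D \<ge> 0" "E \<ge> 0" "F \<ge> 0"
    "\<And>n p x H. p \<noteq> 0 \<Longrightarrow> degree p \<le> k \<Longrightarrow> (\<And>i. \<bar>coeff p i\<bar> \<le> int H) \<Longrightarrow>
       ipoly p x = 0 \<Longrightarrow> cmod x \<le> R \<Longrightarrow> ipoly p (\<beta> n) \<noteq> 0 \<Longrightarrow>
       dist x (\<beta> n) \<ge> exp (- (D * ln (real H) + E * real (s n) + F))"
proof -
  \<comment> \<open>a disc of radius \<open>R'\<close> contains \<open>x\<close> and all partial sums\<close>
  define R' where "R' = max 1 (max R (real A / (1 - cmod \<alpha>)))"
  define L where "L = real (Suc k) ^ 2 * R' ^ k"
  define C where "C = real (d * relation_bound 1)"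
  \<comment> \<open>logarithms of the factors in the estimate \<open>1 \<le> C L Y\<^bsup>d d\<^esup> H dist x (\<beta> n)\<close> proved below\<close>
  define D where "D = real (d * d) + 1"
  define E where "E = real (d * d) * (real k * ln (2 * K))"
  define F where "F = ln (C * L) + real (d * d) * (ln (Suc k) + real k * (real d * ln K + ln A))"
  have R': "R' \<ge> 1" by (simp add: R'_def)
  have L: "L \<ge> 1"
  proof -
    have "1 \<le> real (Suc k) ^ 2" "1 \<le> R' ^ k" using R' by (auto intro!: one_le_power)
    thus ?thesis unfolding L_def using mult_mono[of 1 "real (Suc k) ^ 2" 1 "R' ^ k"] by simp
  qed
  have C: "C \<ge> 1"
  proof -
    have "0 < d * relation_bound 1" using relation_bound_ge_1[of 1] d_pos by simp
    thus ?thesis unfolding C_def by linarith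
  qed
  have CL: "C * L \<ge> 1" using mult_mono[of 1 C 1 L] C L by simp
  have lnK: "ln K \<ge> 0" "ln (2 * K) \<ge> 0" "ln A \<ge> 0" using K_pos A_pos by auto
  show ?thesis
  proof (rule that[of D E F])
    show "D \<ge> 0" "E \<ge> 0" "F \<ge> 0" using lnK CL by (auto simp: D_def E_def F_def)
    fix n p x H
    assume p: "p \<noteq> 0" "degree p \<le> k" "\<And>i. \<bar>coeff p i\<bar> \<le> int H"
      and x: "ipoly p x = 0" "cmod x \<le> R" and nz: "ipoly p (\<beta> n) \<noteq> 0"
    have "coeff p (degree p) \<noteq> 0" using p(1) by simp
    hence H: "H \<ge> 1" using p(3)[of "degree p"] by linarith
    define X where "X = A * (2 * K) ^ s n"
    have X: "X \<ge> 1" using size_bound_ge_1 by (simp add: X_def)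
    define Y where "Y = Suc k * (H * (K ^ d * X) ^ k)"
    have "Y > 0"
      unfolding Y_def using H X K_pos by (intro mult_pos_pos zero_less_power) auto
    hence Y: "Y \<ge> 1" by simp
    have size: "size_le (ipoly p (\<beta> n)) Y"
      unfolding Y_def using size_le_poly[OF _ X p(2,3)] size_partial_sum X_def by simp
    have "real (d * relation_bound Y) = C * real Y ^ (d * d)"
      by (subst relation_bound_eq) (simp add: C_def)
    hence "1 \<le> C * real Y ^ (d * d) * cmod (ipoly p (\<beta> n))"
      using liouville_lower_bound[OF size Y nz] by simp
    moreover have "cmod (ipoly p (\<beta> n)) \<le> real H * L * dist x (\<beta> n)"
      using ipoly_diff_bound[OF p(2,3), of "\<beta> n" R' x] x cmod_partial_sum[of n] R'
      by (simp add: R'_def L_def dist_norm norm_minus_commute)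
    hence "C * real Y ^ (d * d) * cmod (ipoly p (\<beta> n)) \<le> C * real Y ^ (d * d) * (real H * L * dist x (\<beta> n))"
      using C by (intro mult_left_mono) auto
    ultimately have main: "1 \<le> (C * L) * real Y ^ (d * d) * real H * dist x (\<beta> n)"
      by (simp add: mult_ac)
    have Ypos: "real Y > 0" "real H > 0" using Y H by auto
    have lnY: "ln (real Y) = ln (Suc k) + ln H + real k * (real d * ln K + (ln A + real (s n) * ln (2 * K)))"
    proof -
      have "ln (real X) = ln A + real (s n) * ln (2 * K)"
        unfolding X_def by (rule ln_size_bound)
      moreover have "real Y = real (Suc k) * (real H * (real K ^ d * real X) ^ k)"
        by (simp only: Y_def of_nat_mult of_nat_power)
      moreover have "real X > 0" "real K > 0" using X K_pos by auto
      ultimately show ?thesis using H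
        by (simp add: ln_mult ln_realpow del: of_nat_Suc)
    qed
    have "D * ln (real H) + E * real (s n) + F
        = ln (C * L) + real (d * d) * ln (real Y) + ln (real H)"
      by (simp only: D_def E_def F_def lnY) (simp add: algebra_simps)
    also have "\<dots> = ln ((C * L) * real Y ^ (d * d) * real H)"
      using C L Ypos by (simp add: ln_mult ln_realpow)
    finally have "exp (- (D * ln (real H) + E * real (s n) + F))
        = inverse ((C * L) * real Y ^ (d * d) * real H)"
      using C L Ypos by (simp add: exp_minus)
    also have "\<dots> \<le> dist x (\<beta> n)"
      using main C L Ypos by (simp add: field_simps)
    finally show "exp (- (D * ln (real H) + E * real (s n) + F)) \<le> dist x (\<beta> n)" .
  qed
qed

lemma height_upper_bound:
  obtains E F :: real where "E \<ge> 0" "F \<ge> 0"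
    "\<And>n. ln (real_of_int (poly_height (min_int_poly (\<beta> n)))) \<le> E * real (s n) + F"
proof -
  define C where "C = relation_bound 1"
  \<comment> \<open>logarithms of the factors of \<open>3\<^sup>d N\<^bsup>d+1\<^esup>\<close>, which bounds \<open>N (N + 2)\<^sup>d\<close>\<close>
  define E where "E = real (d + 1) * (real (d * d) * ln (2 * K))"
  define F where "F = real d * ln 3 + real (d + 1) * (ln C + real (d * d) * ln A)"
  have C: "C \<ge> 1" unfolding C_def by (rule relation_bound_ge_1) simp
  have lnK: "ln (2 * K) \<ge> 0" "ln A \<ge> 0" using K_pos A_pos by auto
  show ?thesis
  proof (rule that[of E F])
    show "E \<ge> 0" "F \<ge> 0" using lnK C by (auto simp: E_def F_def)
    fix n
    define X where "X = A * (2 * K) ^ s n"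
    have X: "X \<ge> 1" using size_bound_ge_1 by (simp add: X_def)
    have size: "size_le (\<beta> n) X" unfolding X_def by (rule size_partial_sum)
    define M where "M = min_int_poly (\<beta> n)"
    have M: "is_min_int_poly M (\<beta> n)"
      unfolding M_def by (rule is_min_int_poly_min_int_poly[OF size_le_imp_algebraic[OF size]])
    define N where "N = relation_bound X"
    have N: "N \<ge> 1" unfolding N_def by (rule relation_bound_ge_1[OF X])
    have "poly_height M \<le> int (N * (N + 2) ^ d)"
      unfolding N_def by (rule poly_height_bound[OF size X M])
    also have "int (N * (N + 2) ^ d) \<le> int (N * (3 * N) ^ d)"
      using N by (intro of_nat_mono mult_left_mono power_mono) auto
    also have "N * (3 * N) ^ d = 3 ^ d * N ^ (d + 1)"
      by (simp add: power_mult_distrib)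
    finally have "real_of_int (poly_height M) \<le> real (3 ^ d * N ^ (d + 1))" by linarith
    moreover have "poly_height M \<ge> 1" using poly_height_ge_1 is_min_int_poly_nonzero[OF M] by blast
    ultimately have "ln (real_of_int (poly_height M)) \<le> ln (real (3 ^ d * N ^ (d + 1)))"
      by (subst ln_le_cancel_iff) auto
    also have "\<dots> = ln (3 ^ d) + ln (real N ^ (d + 1))"
      using N ln_mult[of "3 ^ d" "real N ^ (d + 1)"] by simp
    also have "\<dots> = real d * ln 3 + real (d + 1) * ln (real N)"
      using N by (simp only: ln_realpow)
    also have "ln (real N) = ln C + real (d * d) * ln (real X)"
      unfolding N_def using C X by (subst relation_bound_eq) (simp add: C_def ln_mult ln_realpow)
    also have "ln (real X) = ln A + real (s n) * ln (2 * K)"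
      unfolding X_def by (rule ln_size_bound)
    finally show "ln (real_of_int (poly_height (min_int_poly (\<beta> n)))) \<le> E * real (s n) + F"
      by (simp add: M_def E_def F_def algebra_simps)
  qed
qed

end

section \<open>Non-stationary partial sums give U-numbers\<close>

context lacunary_value
begin

lemma eventually_gap_dominates:
  assumes "l > 0"
  shows "\<forall>\<^sub>F n in sequentially. c * real (s n) + b < l * real (t n)"
proof -
  have "\<forall>\<^sub>F n in sequentially. 2 * b / l < real (t n)"
    using filterlim_t by (simp add: filterlim_at_top_dense)
  with eventually_ratio_ge[OF ratio_at_top, of "2 * c / l"] show ?thesis
  proof eventually_elim
    case (elim n)
    have "2 * c * real (s n) \<le> l * real (t n)" "2 * b < l * real (t n)"
      using elim assms by (simp_all add: field_simps)
    thus ?case by linarith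
  qed
qed

text \<open>
  The partial sums converge, so not being eventually equal to the limit means not being eventually
  constant, nor even eventually confined to a finite set.
\<close>
context
  assumes varies: "\<not> (\<forall>\<^sub>F n in sequentially. \<beta> n = \<gamma>)"
begin

lemma generator_nonzero: "\<alpha> \<noteq> 0"
proof
  assume "\<alpha> = 0"
  have const: "\<beta> n = of_int (a 0)" for n
  proof -
    have "\<beta> n = (\<Sum>k\<in>{0}. of_int (a k) * \<alpha> ^ k)"
      unfolding \<beta>_def by (rule sum.mono_neutral_right) (use \<open>\<alpha> = 0\<close> in auto)
    thus ?thesis by simp
  qed
  have "(\<lambda>n::nat. of_int (a 0) :: complex) \<longlonglongrightarrow> \<gamma>"
    using partial_sums_tendsto by (simp add: const[abs_def])
  hence "\<gamma> = of_int (a 0)" by (simp add: LIMSEQ_const_iff)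
  thus False using varies by (simp add: const)
qed

lemma finite_values_impossible:
  assumes "finite S" shows "\<not> (\<forall>\<^sub>F n in sequentially. \<beta> n \<in> S)"
  using eventually_eq_limit_if_finite_values[OF partial_sums_tendsto assms] varies by blast

lemma dist_partial_sum_exp:
  obtains G l where "l > 0" "\<And>n. n \<ge> 1 \<Longrightarrow> dist \<gamma> (\<beta> n) \<le> exp (G - l * real (t n))"
proof (rule that)
  have pos: "cmod \<alpha> > 0" using generator_nonzero by simp
  show "- ln (cmod \<alpha>) > 0" using pos inside by simp
  fix n :: nat assume "n \<ge> 1"
  have "exp (ln (real A / (1 - cmod \<alpha>)) - (- ln (cmod \<alpha>)) * real (t n))
      = real A / (1 - cmod \<alpha>) * cmod \<alpha> ^ t n"
    using pos inside A_pos by (simp add: exp_add mult.commute[of "ln _"] exp_of_nat_mult)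
  thus "dist \<gamma> (\<beta> n) \<le> exp (ln (real A / (1 - cmod \<alpha>)) - (- ln (cmod \<alpha>)) * real (t n))"
    using dist_partial_sum[OF \<open>n \<ge> 1\<close>] by simp
qed

text \<open>
  Otherwise the minimal polynomial of \<open>\<gamma>\<close> is an annihilator of height and degree independent of \<open>n\<close>,
  and the lower bound for the distance to \<open>\<beta>\<^sub>n\<close> loses against the gap, unless \<open>\<beta>\<^sub>n\<close> is one of its
  finitely many roots.
\<close>
lemma transcendental: "\<not> algebraic \<gamma>"
proof
  assume "algebraic \<gamma>"
  then obtain M where M: "is_min_int_poly M \<gamma>" using is_min_int_poly_exists by blast
  hence M0: "M \<noteq> 0" "ipoly M \<gamma> = 0" by (auto simp: is_min_int_poly_def)
  define H where "H = nat (poly_height M)"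
  have H: "\<bar>coeff M i\<bar> \<le> int H" for i
    unfolding H_def using coeff_le_poly_height[of M i] by linarith
  obtain D E F where "D \<ge> 0" "E \<ge> 0" "F \<ge> 0" and
    low: "\<And>n p x H. p \<noteq> 0 \<Longrightarrow> degree p \<le> degree M \<Longrightarrow> (\<And>i. \<bar>coeff p i\<bar> \<le> int H) \<Longrightarrow>
       ipoly p x = 0 \<Longrightarrow> cmod x \<le> cmod \<gamma> \<Longrightarrow> ipoly p (\<beta> n) \<noteq> 0 \<Longrightarrow>
       dist x (\<beta> n) \<ge> exp (- (D * ln (real H) + E * real (s n) + F))"
    by (rule annihilator_lower_bound[of "degree M" "cmod \<gamma>"]) blast
  obtain G l where up: "l > 0" "\<And>n. n \<ge> 1 \<Longrightarrow> dist \<gamma> (\<beta> n) \<le> exp (G - l * real (t n))"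
    by (rule dist_partial_sum_exp) blast
  have "\<forall>\<^sub>F n in sequentially. \<beta> n \<in> {x. ipoly M x = 0}"
    using eventually_gap_dominates[OF up(1), of E "D * ln (real H) + F + G"] eventually_ge_at_top[of 1]
  proof eventually_elim
    case (elim n)
    have "exp (G - l * real (t n)) < exp (- (D * ln (real H) + E * real (s n) + F))"
      using elim by simp
    hence "\<not> dist \<gamma> (\<beta> n) \<ge> exp (- (D * ln (real H) + E * real (s n) + F))"
      using up(2)[OF elim(2)] by linarith
    thus ?case using low[OF M0(1) order_refl H M0(2) order_refl, of n] by blast
  qed
  moreover have "finite {x. ipoly M x = 0}"
    by (rule poly_roots_finite) (use M0 in \<open>simp add: map_poly_eq_0_iff\<close>)
  ultimately show False using finite_values_impossible by blast
qed

text \<open>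
  Rational partial sums are integers. Infinitely many of them would force their limit \<open>\<gamma>\<close> into the
  closed set \<open>\<int>\<close>, against transcendence.
\<close>
lemma eventually_irrational:
  assumes M: "is_min_int_poly M \<alpha>" "d \<le> degree M"
  shows "\<forall>\<^sub>F n in sequentially. \<beta> n \<notin> \<rat>"
proof -
  have rat_int: "\<beta> n \<in> \<int>" if "\<beta> n \<in> \<rat>" for n
  proof -
    obtain r where r: "\<beta> n = (\<Sum>i<d. of_int (r i) * \<alpha> ^ i)"
      using size_partial_sum[of n] by (auto elim: size_leE)
    show ?thesis using rational_combination_is_int[OF M d_pos, of r] that r by simp
  qed
  have "\<gamma> \<notin> \<int>" using transcendental int_imp_algebraic_int algebraic_int_imp_algebraic by blast
  moreover have op: "open (- (\<int> :: complex set))" by (intro open_Compl closed_Ints)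
  ultimately have "\<forall>\<^sub>F n in sequentially. \<beta> n \<in> - \<int>"
    by (intro topological_tendstoD[OF partial_sums_tendsto op]) simp
  thus ?thesis by eventually_elim (use rat_int in auto)
qed

text \<open>
  The field generated by an irrational partial sum is a subfield of \<open>\<rat>(\<alpha>)\<close> other than \<open>\<rat>\<close>, so by
  simplicity it is \<open>\<rat>(\<alpha>)\<close>.
\<close>
lemma eventually_same_degree:
  assumes M: "is_min_int_poly M \<alpha>" "d \<le> degree M" and simple: "simple_algebraic \<alpha>"
  shows "\<forall>\<^sub>F n in sequentially. alg_degree (\<beta> n) = alg_degree \<alpha>"
  using eventually_irrational[OF M]
proof eventually_elim
  case (elim n)
  have "\<beta> n \<in> rat_adjoin \<alpha>"
    unfolding \<beta>_def
    by (intro complex_subfield_sum complex_subfield_mult complex_subfield_of_int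
        complex_subfield_power complex_subfield_rat_adjoin in_rat_adjoin)
  hence "rat_adjoin (\<beta> n) \<subseteq> rat_adjoin \<alpha>"
    by (rule rat_adjoin_minimal[OF complex_subfield_rat_adjoin])
  moreover have "rat_adjoin (\<beta> n) \<noteq> \<rat>" using elim in_rat_adjoin by blast
  ultimately have "rat_adjoin (\<beta> n) = rat_adjoin \<alpha>"
    using simple complex_subfield_rat_adjoin unfolding simple_algebraic_def by blast
  thus ?case by (simp add: alg_degree_def)
qed

text \<open>
  If only finitely many numbers satisfied the inequality for \<open>w\<close>, the partial sums, which satisfy it
  from some index on, would be confined to a finite set.
\<close>
lemma U_approx_if_degree:
  assumes deg: "\<forall>\<^sub>F n in sequentially. alg_degree (\<beta> n) = m"
  shows "U_approx m \<gamma>"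
  unfolding U_approx_def
proof (intro allI impI notI)
  fix w :: real
  define S where "S = {\<beta>. algebraic \<beta> \<and> alg_degree \<beta> = m \<and>
    cmod (\<gamma> - \<beta>) < real_of_int (poly_height (min_int_poly \<beta>)) powr (- w)}"
  assume w: "w > 0" and fin: "finite S"
  obtain E F where EF: "E \<ge> 0" "F \<ge> 0"
    "\<And>n. ln (real_of_int (poly_height (min_int_poly (\<beta> n)))) \<le> E * real (s n) + F"
    by (rule height_upper_bound) blast
  obtain G l where up: "l > 0" "\<And>n. n \<ge> 1 \<Longrightarrow> dist \<gamma> (\<beta> n) \<le> exp (G - l * real (t n))"
    by (rule dist_partial_sum_exp) blast
  have "\<forall>\<^sub>F n in sequentially. \<beta> n \<in> S"
    using deg eventually_gap_dominates[OF up(1), of "w * E" "w * F + G"] eventually_ge_at_top[of 1]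
  proof eventually_elim
    case (elim n)
    have alg: "algebraic (\<beta> n)" using size_le_imp_algebraic[OF size_partial_sum] .
    define h where "h = real_of_int (poly_height (min_int_poly (\<beta> n)))"
    have "poly_height (min_int_poly (\<beta> n)) \<ge> 1"
      using is_min_int_poly_min_int_poly[OF alg] is_min_int_poly_nonzero poly_height_ge_1 by blast
    hence h: "h \<ge> 1" by (simp add: h_def)
    have "w * ln h \<le> w * (E * real (s n) + F)"
      using EF(3)[of n] w by (simp add: h_def)
    hence "G - l * real (t n) < - w * ln h" using elim(2) by (simp add: algebra_simps)
    hence "exp (G - l * real (t n)) < h powr (- w)" using h by (simp add: powr_def)
    hence "cmod (\<gamma> - \<beta> n) < h powr (- w)" using up(2)[OF elim(3)] by (simp add: dist_norm)
    thus ?case using alg elim(1) by (simp add: S_def h_def)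
  qed
  thus False using finite_values_impossible[OF fin] by blast
qed

text \<open>
  A number \<open>x\<close> of degree \<open>k\<close> in the unit disc around \<open>\<gamma>\<close> has distance at least \<open>exp (- (w h + W))\<close> from \<open>\<gamma>\<close>, where \<open>h\<close> is its
  logarithmic height. With the exponent \<open>w + 1\<close> an approximation therefore satisfies \<open>h < W\<close>, and
  only finitely many numbers of degree \<open>k\<close> do so.
\<close>
lemma not_U_approx_below_degree:
  assumes deg: "\<forall>\<^sub>F n in sequentially. alg_degree (\<beta> n) = m" and k: "0 < k" "k < m"
  shows "\<not> U_approx k \<gamma>"
proof
  assume U: "U_approx k \<gamma>"
  obtain n0 where n0: "\<And>n. n \<ge> n0 \<Longrightarrow> alg_degree (\<beta> n) = m"
    using deg by (auto simp: eventually_sequentially)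
  obtain D E F where DEF: "D \<ge> 0" "E \<ge> 0" "F \<ge> 0" and
    low: "\<And>n p x H. p \<noteq> 0 \<Longrightarrow> degree p \<le> k \<Longrightarrow> (\<And>i. \<bar>coeff p i\<bar> \<le> int H) \<Longrightarrow>
       ipoly p x = 0 \<Longrightarrow> cmod x \<le> cmod \<gamma> + 1 \<Longrightarrow> ipoly p (\<beta> n) \<noteq> 0 \<Longrightarrow>
       dist x (\<beta> n) \<ge> exp (- (D * ln (real H) + E * real (s n) + F))"
    by (rule annihilator_lower_bound[of k "cmod \<gamma> + 1"]) blast
  obtain G l where up: "l > 0" "\<And>n. n \<ge> 1 \<Longrightarrow> dist \<gamma> (\<beta> n) \<le> exp (G - l * real (t n))"
    by (rule dist_partial_sum_exp) blast
  obtain w W where w: "w \<ge> 0" and far: "\<And>x h. h \<ge> 0 \<Longrightarrow>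
      (\<And>n. n \<ge> n0 \<Longrightarrow> dist x (\<beta> n) \<ge> exp (- (D * h + E * real (s n) + F))) \<Longrightarrow>
      dist \<gamma> x \<ge> exp (- (w * h + W))"
    by (rule gap_approximation_bound[OF chain ratio_at_top ratio_bounded up(2) up(1) DEF, of n0]) blast+
  define S where "S = {x. algebraic x \<and> alg_degree x = k \<and>
    cmod (\<gamma> - x) < real_of_int (poly_height (min_int_poly x)) powr (- (w + 1))}"
  have "S \<subseteq> {x. \<exists>p. p \<noteq> 0 \<and> degree p \<le> k \<and> (\<forall>i. \<bar>coeff p i\<bar> \<le> \<lceil>exp W\<rceil>) \<and> ipoly p x = 0}"
  proof
    fix x assume "x \<in> S"
    hence x: "algebraic x" "alg_degree x = k"
      "cmod (\<gamma> - x) < real_of_int (poly_height (min_int_poly x)) powr (- (w + 1))"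
      by (auto simp: S_def)
    define M where "M = min_int_poly x"
    have M: "is_min_int_poly M x" unfolding M_def by (rule is_min_int_poly_min_int_poly[OF x(1)])
    have M0: "M \<noteq> 0" "ipoly M x = 0" using M by (auto simp: is_min_int_poly_def)
    have degM: "degree M \<le> k" using degree_min_int_poly_le_alg_degree[OF M] x(2) k(1) by simp
    define H where "H = nat (poly_height M)"
    have "poly_height M \<ge> 1" using poly_height_ge_1[OF M0(1)] .
    hence H: "H \<ge> 1" "int H = poly_height M" by (auto simp: H_def)
    have HM: "real_of_int (poly_height M) = real H" using H(2) by (metis of_int_of_nat_eq)
    have coeffs: "\<bar>coeff M i\<bar> \<le> int H" for i using coeff_le_poly_height[of M i] H(2) by simp
    define h where "h = ln (real H)"
    have h: "h \<ge> 0" using H by (simp add: h_def)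
    have close: "dist \<gamma> x < exp (- ((w + 1) * h))"
    proof -
      have "real H powr (- (w + 1)) = exp (- ((w + 1) * h))"
        using H by (simp only: powr_def h_def mult_minus_left) simp
      thus ?thesis using x(3) by (simp only: M_def[symmetric] HM dist_norm)
    qed
    also have "\<dots> \<le> 1" using w h by (simp add: mult_nonneg_nonneg)
    finally have "dist \<gamma> x < 1" .
    hence norm_x: "cmod x \<le> cmod \<gamma> + 1"
      using norm_triangle_ineq2[of x \<gamma>] by (simp add: dist_norm norm_minus_commute)
    \<comment> \<open>a root of \<open>M\<close> has degree at most \<open>k\<close>, and \<open>\<beta> n\<close> has degree \<open>m > k\<close>\<close>
    have "ipoly M (\<beta> n) \<noteq> 0" if "n \<ge> n0" for n
    proof
      assume "ipoly M (\<beta> n) = 0"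
      hence "alg_degree (\<beta> n) \<le> degree M" by (rule alg_degree_le_degree[OF M0(1)])
      thus False using n0[OF that] degM k(2) by simp
    qed
    hence "dist x (\<beta> n) \<ge> exp (- (D * h + E * real (s n) + F))" if "n \<ge> n0" for n
      using low[OF M0(1) degM coeffs M0(2) norm_x] that by (simp add: h_def)
    hence "dist \<gamma> x \<ge> exp (- (w * h + W))" by (rule far[OF h])
    hence "exp (- (w * h + W)) < exp (- ((w + 1) * h))" using close by linarith
    hence "h < W" by (simp add: algebra_simps)
    hence "exp h < exp W" by simp
    hence "real H < exp W" using H by (simp add: h_def)
    hence "int H \<le> \<lceil>exp W\<rceil>" by linarith
    hence "\<forall>i. \<bar>coeff M i\<bar> \<le> \<lceil>exp W\<rceil>" using coeffs order.trans by blast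
    thus "x \<in> {x. \<exists>p. p \<noteq> 0 \<and> degree p \<le> k \<and> (\<forall>i. \<bar>coeff p i\<bar> \<le> \<lceil>exp W\<rceil>) \<and> ipoly p x = 0}"
      using M0 degM by blast
  qed
  hence "finite S" by (rule finite_subset[OF _ finite_roots_of_bounded_int_polys])
  moreover have "w + 1 > 0" using w by simp
  hence "infinite S" using U unfolding U_approx_def S_def by blast
  ultimately show False by blast
qed

end

lemma value_in_U_set:
  assumes "\<not> (\<forall>\<^sub>F n in sequentially. \<beta> n = \<gamma>)"
    and "is_min_int_poly M \<alpha>" "d \<le> degree M" "simple_algebraic \<alpha>" "alg_degree \<alpha> > 0"
  shows "\<gamma> \<in> U_set (alg_degree \<alpha>)"
proof -
  note deg = eventually_same_degree[OF assms(1-4)]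
  show ?thesis
    unfolding U_set_def
    using transcendental[OF assms(1)] U_approx_if_degree[OF assms(1) deg]
      not_U_approx_below_degree[OF assms(1) deg] assms(5) by blast
qed

text \<open>
  Two equal partial sums differ by a block of the series, a polynomial in \<open>\<alpha>\<close>. It is a non-zero
  polynomial once the block is long enough to contain one of the infinitely many non-zero
  coefficients.
\<close>
lemma min_int_poly_bounded_if_stationary:
  assumes stat: "\<forall>\<^sub>F n in sequentially. \<beta> n = \<gamma>" and inf: "infinite {k. a k \<noteq> 0}"
    and M: "is_min_int_poly M \<alpha>"
  shows "\<bar>coeff M i\<bar> \<le> int (A * (A + 2) ^ degree M)"
proof -
  obtain N where N: "\<And>n. n \<ge> N \<Longrightarrow> \<beta> n = \<gamma>" using stat by (auto simp: eventually_sequentially)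
  obtain k where k: "k > s N" "a k \<noteq> 0"
    using inf by (auto simp: infinite_nat_iff_unbounded)
  define n where "n = Suc (max N k)"
  have "k \<le> s n"
    using interlaced_ge_index(2)[of t s "max N k", OF chain] by (simp add: n_def)
  obtain p where p: "\<And>i. coeff p i = (if i \<le> s n then if i \<le> s N then 0 else a i else 0)"
    "degree p \<le> s n"
    "\<And>x. ipoly p x = (\<Sum>i\<le>s n. of_int (if i \<le> s N then 0 else a i) * x ^ i)"
    using ipoly_of_coeffs[of "s n" "\<lambda>i. if i \<le> s N then 0 else a i"] by blast
  have "ipoly p \<alpha> = (\<Sum>i\<in>{..s n} - {..s N}. of_int (a i) * \<alpha> ^ i)"
    unfolding p(3) by (rule sum.mono_neutral_cong_right) auto
  also have "\<dots> = \<beta> n - \<beta> N"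
    unfolding \<beta>_def by (rule sum_diff) (use \<open>k \<le> s n\<close> k(1) in auto)
  also have "\<dots> = 0" using N[of n] N[of N] by (simp add: n_def)
  finally have "M dvd p" by (rule is_min_int_poly_dvd_annihilator[OF M])
  moreover have "p \<noteq> 0" using p(1)[of k] k \<open>k \<le> s n\<close> by auto
  moreover have "\<bar>coeff p i\<bar> \<le> int A" for i using coeffs_bounded[of i] by (simp add: p(1))
  ultimately show ?thesis by (rule coeff_bound_divisor)
qed

end

section \<open>Finiteness of the exceptional set\<close>

lemma monic_min_int_poly:
  assumes "algebraic_int x"
  obtains M where "is_min_int_poly M x" "lead_coeff M = 1"
proof -
  obtain p where p: "ipoly p x = 0" "lead_coeff p = 1"
    using assms by (auto simp: algebraic_int_altdef_ipoly)
  obtain M where M: "is_min_int_poly M x"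
    using is_min_int_poly_exists algebraic_int_imp_algebraic[OF assms] by blast
  obtain r where "p = M * r" using is_min_int_poly_dvd_annihilator[OF M p(1)] by (elim dvdE)
  hence "lead_coeff M * lead_coeff r = 1" using p(2) by (simp add: lead_coeff_mult)
  hence "lead_coeff M dvd 1" by (metis dvd_triv_left)
  hence "lead_coeff M = 1 \<or> lead_coeff (- M) = 1"
    by (simp add: lead_coeff_minus abs_if split: if_splits)
  moreover have "is_min_int_poly (- M) x"
  proof -
    have "irreducible (- M)"
      using M irreducible_mult_unit_left[of "- 1" M] by (simp add: is_min_int_poly_def)
    moreover have "ipoly (- M) x = 0"
      using M ipoly_mult[of "- 1" M x] by (simp add: is_min_int_poly_def)
    ultimately show ?thesis by (simp add: is_min_int_poly_def)
  qed
  ultimately show ?thesis using that M by blast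
qed

lemma integral_relation_if_monic:
  assumes M: "is_min_int_poly M x" "lead_coeff M = 1"
  shows "integral_relation x (degree M) (\<lambda>i. - coeff M i) (nat (1 + (\<Sum>i<degree M. \<bar>- coeff M i\<bar>)))"
proof
  show "degree M > 0" using is_min_int_poly_degree_pos[OF M(1)] .
  have "0 = (\<Sum>i<degree M. of_int (coeff M i) * x ^ i) + x ^ degree M"
    using M ipoly_altdef[of M "degree M" x]
    by (simp add: is_min_int_poly_def flip: lessThan_Suc_atMost)
  thus "x ^ degree M = (\<Sum>i<degree M. of_int (- coeff M i) * x ^ i)"
    by (simp add: sum_negf eq_neg_iff_add_eq_0 add.commute)
qed simp

theorem corollary1p7:
  fixes f :: "int fps" and m :: nat
  assumes "generalized_liouville f" and "bounded_type f" and "m > 0"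
  shows "finite {\<alpha>. simple_algebraic \<alpha> \<and> algebraic_int \<alpha> \<and> alg_degree \<alpha> = m \<and> cmod \<alpha> < 1 \<and>
                    eval_fps (complex_series f) \<alpha> \<notin> U_set m}"
proof -
  define a where "a = fps_nth f"
  obtain s t :: "nat \<Rightarrow> nat" and B where st:
    "\<And>n. n \<ge> 1 \<Longrightarrow> t (n - 1) \<le> s n \<and> s n < t n"
    "\<And>n k. n \<ge> 1 \<Longrightarrow> s n < k \<Longrightarrow> k < t n \<Longrightarrow> a k = 0"
    "filterlim (\<lambda>n. real (t n) / real (s n)) at_top sequentially"
    "\<And>n. n \<ge> 1 \<Longrightarrow> real (s (n + 1)) / real (t n) \<le> B"
    using assms(1) unfolding generalized_liouville_def a_def by blast
  have inf: "infinite {k. a k \<noteq> 0}"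
    using assms(1) by (simp add: generalized_liouville_def a_def)
  obtain A' :: real where A': "A' > 0" "\<And>k. \<bar>of_int (a k)\<bar> \<le> A'"
    using assms(2) unfolding bounded_type_def a_def by blast
  define A where "A = nat \<lceil>A'\<rceil>"
  have A: "A \<ge> 1" "\<bar>a k\<bar> \<le> int A" for k
  proof -
    show "A \<ge> 1" using A'(1) unfolding A_def by linarith
    have "real_of_int \<bar>a k\<bar> \<le> A'" using A'(2)[of k] by simp
    thus "\<bar>a k\<bar> \<le> int A" unfolding A_def by linarith
  qed
  define S where "S = {x. \<exists>p. p \<noteq> 0 \<and> degree p \<le> m \<and>
    (\<forall>i. \<bar>coeff p i\<bar> \<le> int (A * (A + 2) ^ m)) \<and> ipoly p x = 0}"
  have fin: "finite S" unfolding S_def by (rule finite_roots_of_bounded_int_polys)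
  have exceptional: "\<alpha> \<in> S"
    if \<alpha>: "simple_algebraic \<alpha>" "algebraic_int \<alpha>" "alg_degree \<alpha> = m" "cmod \<alpha> < 1"
      "eval_fps (complex_series f) \<alpha> \<notin> U_set m" for \<alpha>
  proof -
    obtain M where M: "is_min_int_poly M \<alpha>" "lead_coeff M = 1"
      using monic_min_int_poly[OF \<alpha>(2)] by blast
    interpret integral_relation \<alpha> "degree M" "\<lambda>i. - coeff M i"
      "nat (1 + (\<Sum>i<degree M. \<bar>- coeff M i\<bar>))"
      by (rule integral_relation_if_monic[OF M])
    interpret lacunary_value \<alpha> "degree M" "\<lambda>i. - coeff M i"
      "nat (1 + (\<Sum>i<degree M. \<bar>- coeff M i\<bar>))" a A s t B
      using \<alpha>(4) A st by unfold_locales auto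
    have "eval_fps (complex_series f) \<alpha> = \<gamma>"
      unfolding \<gamma>_def by (simp add: eval_fps_def complex_series_def a_def)
    hence "\<gamma> \<notin> U_set (alg_degree \<alpha>)" using \<alpha> by simp
    moreover have "alg_degree \<alpha> > 0" using \<alpha>(3) assms(3) by simp
    ultimately have "\<forall>\<^sub>F n in sequentially. \<beta> n = \<gamma>"
      using value_in_U_set[OF _ M(1) order_refl \<alpha>(1)] by blast
    hence bound: "\<bar>coeff M i\<bar> \<le> int (A * (A + 2) ^ degree M)" for i
      by (rule min_int_poly_bounded_if_stationary[OF _ inf M(1)])
    have deg: "degree M \<le> m"
      using degree_min_int_poly_le_alg_degree[OF M(1)] \<alpha>(3) assms(3) by simp
    have "A * (A + 2) ^ degree M \<le> A * (A + 2) ^ m"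
      using deg by (intro mult_left_mono power_increasing) auto
    hence "\<bar>coeff M i\<bar> \<le> int (A * (A + 2) ^ m)" for i
      using bound[of i] by (meson of_nat_le_iff order.trans)
    thus ?thesis unfolding S_def
      using deg M(1) is_min_int_poly_nonzero[OF M(1)] by (auto simp: is_min_int_poly_def)
  qed
  show ?thesis by (rule finite_subset[OF _ fin]) (use exceptional in blast)
qed

end
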